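(* Let $V\subset L^2(\mathbb{R})$ be a shift-invariant space with a single Riesz generator $\phi\in L^2(\mathbb{R})$ with lower and upper Riesz bounds $A$ and $B$ respectively. If $\psi\in V$ is such that there exists a constant $\mu>0$ for which $$\sum_{k\in\mathbb{Z}}\left|\widehat\phi(\zeta+k)-\widehat\psi(\zeta+k)\right|^2\le\mu<A<\sum_{k\in\mathbb{Z}}\left|\widehat\phi(\zeta+k)\right|^2\quad\text{for a.e. }\zeta\in[-1/2,1/2),$$ then $\{t_k\psi:k\in\mathbb{Z}\}$ is a Riesz basis of $V$ woven with $\{t_k\phi:k\in\mathbb{Z}\}$.
   Context: For $k\in\mathbb{Z}$, $t_kf:=f(\cdot-k)$. A closed subspace $V\subset L^2(\mathbb{R})$ is shift-invariant if $t_kf\in V$ for all $f\in V$, $k\in\mathbb{Z}$. The Fourier transform is $\widehat f(\xi)=\int f(x)e^{-2\pi ix\xi}\,dx$. A family in a Hilbert space is a frame if there are $a,b>0$ with $a\|f\|^2\le\sum_i|\langle f,x_i\rangle|^2\le b\|f\|^2$ for all $f$; it is a Riesz basis if it is a frame and there are $a,b>0$ with $a\|c\|_2^2\le\|\sum_ic_ix_i\|^2\le b\|c\|_2^2$ for all finitely supported $c$. That $\phi$ is a Riesz generator of $V$ means that $\{t_k\phi:k\in\mathbb{Z}\}$ is a Riesz basis of $V$; its lower and upper Riesz bounds $A,B>0$ satisfy $A\|c\|_2^2\le\|\sum_kc_kt_k\phi\|^2\le B\|c\|_2^2$ for all finitely supported $c$, equivalently $A\le\sum_{m\in\mathbb{Z}}|\widehat\phi(\zeta+m)|^2\le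 B$ for a.e. $\zeta\in[-1/2,1/2)$. Two frames $\{x_k\}_{k\in\mathbb{Z}}$ and $\{y_k\}_{k\in\mathbb{Z}}$ of $V$ are woven if for every $J\subset\mathbb{Z}$ the indexed family $\{x_k\}_{k\in J}\cup\{y_k\}_{k\in\mathbb{Z}\setminus J}$ is a frame of $V$. *)

theory Defs
  imports "HOL-Analysis.Analysis"
begin

text \<open>
  Elements of \<open>L\<^sup>2(\<real>)\<close> are represented by Borel functions rather than by classes modulo null
  sets (every class has a Borel representative). Thus \<open>L2_norm\<close> is only a seminorm; the closed
  subspaces defined below are saturated under almost everywhere equality.
\<close>

definition L2 :: "(real \<Rightarrow> complex) set" where
  "L2 = {f \<in> borel_measurable lborel. integrable lborel (\<lambda>x. (cmod (f x))\<^sup>2)}"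

definition L2_inner :: "(real \<Rightarrow> complex) \<Rightarrow> (real \<Rightarrow> complex) \<Rightarrow> complex" where
  "L2_inner f g = (LINT x|lborel. f x * cnj (g x))"

definition L2_norm :: "(real \<Rightarrow> complex) \<Rightarrow> real" where
  "L2_norm f = sqrt (LINT x|lborel. (cmod (f x))\<^sup>2)"

text \<open>
  Membership in \<open>L2\<close> is demanded explicitly because the Bochner integral in \<open>L2_norm\<close>
  is \<open>0\<close> when the integrand is not integrable.
\<close>

definition L2_tendsto :: "(nat \<Rightarrow> real \<Rightarrow> complex) \<Rightarrow> (real \<Rightarrow> complex) \<Rightarrow> bool" where
  "L2_tendsto u f \<longleftrightarrow>
     (\<forall>n. u n \<in> L2) \<and> f \<in> L2 \<and> (\<lambda>n. L2_norm (\<lambda>x. u n x - f x)) \<longlonglongrightarrow> 0"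

definition closed_L2_subspace :: "(real \<Rightarrow> complex) set \<Rightarrow> bool" where
  "closed_L2_subspace V \<longleftrightarrow>
     V \<subseteq> L2 \<and> (\<lambda>x. 0) \<in> V \<and>
     (\<forall>f\<in>V. \<forall>g\<in>V. (\<lambda>x. f x + g x) \<in> V) \<and>
     (\<forall>c. \<forall>f\<in>V. (\<lambda>x. c * f x) \<in> V) \<and>
     (\<forall>u f. (\<forall>n. u n \<in> V) \<longrightarrow> L2_tendsto u f \<longrightarrow> f \<in> V)"

definition shift :: "int \<Rightarrow> (real \<Rightarrow> complex) \<Rightarrow> real \<Rightarrow> complex" where
  "shift k f = (\<lambda>x. f (x - of_int k))"

definition shift_invariant_space :: "(real \<Rightarrow> complex) set \<Rightarrow> bool" where
  "shift_invariant_space V \<longleftrightarrow> closed_L2_subspace V \<and> (\<forall>f\<in>V. \<forall>k. shift k f \<in> V)"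

definition fourier_integral :: "(real \<Rightarrow> complex) \<Rightarrow> real \<Rightarrow> complex" where
  "fourier_integral f \<xi> = (LINT x|lborel. f x * exp (- (2 * of_real pi * \<i> * of_real x * of_real \<xi>)))"

text \<open>
  For a general \<open>f \<in> L\<^sup>2(\<real>)\<close> the Fourier integral need not converge. The \<open>L\<^sup>2\<close> Fourier transform
  is the \<open>L\<^sup>2\<close>-limit of the Fourier integrals of the truncations of \<open>f\<close> to \<open>[-n, n]\<close>, which
  exists by Plancherel's theorem and is unique up to null sets; one representative is chosen.
\<close>

definition fourier :: "(real \<Rightarrow> complex) \<Rightarrow> real \<Rightarrow> complex" where
  "fourier f = (SOME g. L2_tendsto
     (\<lambda>n. fourier_integral (\<lambda>x. indicator {- real n..real n} x * f x)) g)"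

definition frame_of :: "(real \<Rightarrow> complex) set \<Rightarrow> ('i \<Rightarrow> real \<Rightarrow> complex) \<Rightarrow> bool" where
  "frame_of V x \<longleftrightarrow> (\<forall>i. x i \<in> V) \<and>
     (\<exists>a>0. \<exists>b>0. \<forall>f\<in>V.
        (\<lambda>i. (cmod (L2_inner f (x i)))\<^sup>2) summable_on UNIV \<and>
        a * (L2_norm f)\<^sup>2 \<le> (\<Sum>\<^sub>\<infinity>i. (cmod (L2_inner f (x i)))\<^sup>2) \<and>
        (\<Sum>\<^sub>\<infinity>i. (cmod (L2_inner f (x i)))\<^sup>2) \<le> b * (L2_norm f)\<^sup>2)"

definition riesz_bounds :: "('i \<Rightarrow> real \<Rightarrow> complex) \<Rightarrow> real \<Rightarrow> real \<Rightarrow> bool" where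
  "riesz_bounds x A B \<longleftrightarrow> A > 0 \<and> B > 0 \<and>
     (\<forall>c::'i \<Rightarrow> complex. finite {i. c i \<noteq> 0} \<longrightarrow>
        A * (\<Sum>i | c i \<noteq> 0. (cmod (c i))\<^sup>2) \<le> (L2_norm (\<lambda>t. \<Sum>i | c i \<noteq> 0. c i * x i t))\<^sup>2 \<and>
        (L2_norm (\<lambda>t. \<Sum>i | c i \<noteq> 0. c i * x i t))\<^sup>2 \<le> B * (\<Sum>i | c i \<noteq> 0. (cmod (c i))\<^sup>2))"

definition riesz_basis :: "(real \<Rightarrow> complex) set \<Rightarrow> ('i \<Rightarrow> real \<Rightarrow> complex) \<Rightarrow> bool" where
  "riesz_basis V x \<longleftrightarrow> frame_of V x \<and> (\<exists>A B. riesz_bounds x A B)"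

definition riesz_generator :: "(real \<Rightarrow> complex) set \<Rightarrow> (real \<Rightarrow> complex) \<Rightarrow> bool" where
  "riesz_generator V \<phi> \<longleftrightarrow> riesz_basis V (\<lambda>k. shift k \<phi>)"

definition woven :: "(real \<Rightarrow> complex) set \<Rightarrow> (int \<Rightarrow> real \<Rightarrow> complex) \<Rightarrow>
    (int \<Rightarrow> real \<Rightarrow> complex) \<Rightarrow> bool" where
  "woven V x y \<longleftrightarrow> frame_of V x \<and> frame_of V y \<and>
     (\<forall>J. frame_of V (\<lambda>k. if k \<in> J then x k else y k))"

end

theory Submission
  imports Defs "HOL-Probability.Characteristic_Functions"
begin

text \<open>
  Write \<open>d = \<phi> - \<psi>\<close>, and \<open>d^\<close> for its Fourier transform. On the Fourier side the finite combination \<open>\<Sum>k. c\<^sub>k t\<^sub>k d\<close> becomes the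
  product of \<open>d^\<close> with the 1-periodic trigonometric polynomial \<open>\<Sum>k. c\<^sub>k e\<^bsup>-2\<pi>ik\<xi>\<^esup>\<close>. Folding the
  real line onto one period, Plancherel's theorem and the hypothesis
  \<open>\<Sum>k. |d^(\<zeta> + k)|\<^sup>2 \<le> \<mu>\<close> give \<open>\<parallel>\<Sum>k. c\<^sub>k t\<^sub>k d\<parallel>\<^sup>2 \<le> \<mu> \<parallel>c\<parallel>\<^sup>2\<close>
  (\<open>periodization_synthesis_bound\<close>).

  This bound survives when the coefficients are restricted to a set \<open>J\<close>. So the
  synthesis operator of any weaving of the translates of \<open>\<psi>\<close> and \<open>\<phi>\<close> differs from that of the
  translates of \<open>\<phi>\<close> by an operator of norm at most \<open>\<surd>\<mu> < \<surd>A\<close>. Families that close to a Riesz basis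
  are again Riesz bases
  (\<open>riesz_basis_perturbation\<close>): by the triangle inequality the synthesis operator stays bounded below
  by \<open>\<surd>A - \<surd>\<mu>\<close>, and so does the analysis operator, because the lower Riesz bound \<open>A\<close> of a Riesz
  basis is also a lower frame bound (\<open>riesz_lower_bound_is_frame_bound\<close>). That the translates
  of \<open>\<psi>\<close> form a Riesz basis is the case \<open>J = UNIV\<close>.

  The analytic input is Plancherel's theorem (\<open>Plancherel_L1_L2\<close>), obtained by integrating
  \<open>|f^|\<^sup>2\<close> against wide Gaussians, and the completeness of \<open>L\<^sup>2\<close> (\<open>L2_complete\<close>), which
  together ensure that the limit selected in the definition of \<open>fourier\<close> exists.
\<close>

section \<open>Square-integrable functions\<close>

lemma L2_measurable: "f \<in> L2 \<Longrightarrow> f \<in> borel_measurable borel"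
  and L2_integrable: "f \<in> L2 \<Longrightarrow> integrable lborel (\<lambda>x. (cmod (f x))\<^sup>2)"
  by (auto simp: L2_def)

lemma L2_I:
  "f \<in> borel_measurable borel \<Longrightarrow> integrable lborel (\<lambda>x. (cmod (f x))\<^sup>2) \<Longrightarrow> f \<in> L2"
  by (auto simp: L2_def)

lemma L2_I_bound:
  assumes "f \<in> borel_measurable borel" "integrable lborel g" "\<And>x. (cmod (f x))\<^sup>2 \<le> g x"
  shows "f \<in> L2"
  using assms
  by (intro L2_I Bochner_Integration.integrable_bound[OF assms(2)])
     (auto intro!: AE_I2 order_trans[OF _ abs_ge_self])

lemma L2_integrable_mult:
  assumes "f \<in> L2" "g \<in> L2"
  shows "integrable lborel (\<lambda>x. f x * g x)"
proof (rule Bochner_Integration.integrable_bound)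
  show "integrable lborel (\<lambda>x. (cmod (f x))\<^sup>2 + (cmod (g x))\<^sup>2)"
    using assms by (intro Bochner_Integration.integrable_add L2_integrable)
  show "(\<lambda>x. f x * g x) \<in> borel_measurable lborel"
    using assms[THEN L2_measurable] by simp
  have "a * b \<le> a\<^sup>2 + b\<^sup>2" for a b :: real
    using sum_squares_bound[of a b] zero_le_power2[of a] zero_le_power2[of b]
    by linarith
  then show "AE x in lborel. norm (f x * g x) \<le> norm ((cmod (f x))\<^sup>2 + (cmod (g x))\<^sup>2)"
    by (auto simp: norm_mult intro!: AE_I2)
qed

lemma L2_cnj: "f \<in> L2 \<Longrightarrow> (\<lambda>x. cnj (f x)) \<in> L2"
  by (auto simp: L2_def intro!: measurable_compose[OF _ borel_measurable_continuous_onI[of cnj]]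
      continuous_intros)

lemma L2_scale:
  assumes "f \<in> L2" shows "(\<lambda>x. c * f x) \<in> L2"
  using assms by (auto simp: L2_def norm_mult power_mult_distrib)

lemma L2_add:
  assumes "f \<in> L2" "g \<in> L2" shows "(\<lambda>x. f x + g x) \<in> L2"
proof (rule L2_I_bound)
  show "integrable lborel (\<lambda>x. 2 * (cmod (f x))\<^sup>2 + 2 * (cmod (g x))\<^sup>2)"
    using assms by (intro Bochner_Integration.integrable_add integrable_mult_right L2_integrable)
  show "(\<lambda>x. f x + g x) \<in> borel_measurable borel"
    using assms[THEN L2_measurable] by simp
  show "(cmod (f x + g x))\<^sup>2 \<le> 2 * (cmod (f x))\<^sup>2 + 2 * (cmod (g x))\<^sup>2" for x
  proof -
    have "(cmod (f x + g x))\<^sup>2 \<le> (cmod (f x) + cmod (g x))\<^sup>2"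
      by (intro power_mono norm_triangle_ineq) auto
    also have "\<dots> \<le> 2 * (cmod (f x))\<^sup>2 + 2 * (cmod (g x))\<^sup>2"
      using sum_squares_bound[of "cmod (f x)" "cmod (g x)"] by (simp add: power2_sum)
    finally show ?thesis .
  qed
qed

lemma L2_diff: "f \<in> L2 \<Longrightarrow> g \<in> L2 \<Longrightarrow> (\<lambda>x. f x - g x) \<in> L2"
  using L2_add[OF _ L2_scale[of g "-1"]] by simp

lemma L2_zero: "(\<lambda>x. 0) \<in> L2"
  by (simp add: L2_def)

lemma L2_sum: "(\<And>i. i \<in> K \<Longrightarrow> f i \<in> L2) \<Longrightarrow> (\<lambda>x. \<Sum>i\<in>K. f i x) \<in> L2"
  by (induction K rule: infinite_finite_induct) (auto simp: L2_zero L2_add)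

lemma L2_integrable_inner:
  "f \<in> L2 \<Longrightarrow> g \<in> L2 \<Longrightarrow> integrable lborel (\<lambda>x. f x * cnj (g x))"
  by (intro L2_integrable_mult L2_cnj)

lemma L2_norm_nonneg: "L2_norm f \<ge> 0"
  by (simp add: L2_norm_def)

lemma L2_norm_square: "(L2_norm f)\<^sup>2 = (LINT x|lborel. (cmod (f x))\<^sup>2)"
  by (simp add: L2_norm_def)

lemma L2_norm_nn_integral:
  assumes "f \<in> L2"
  shows "(\<integral>\<^sup>+x. ennreal ((cmod (f x))\<^sup>2) \<partial>lborel) = ennreal ((L2_norm f)\<^sup>2)"
  using nn_integral_eq_integral[OF L2_integrable[OF assms]] by (simp add: L2_norm_square)

text \<open>
  A finite bound on the nonnegative integral yields membership and norm bound at once. The norm alone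
  would not do, since it vanishes on functions that are not square integrable.
\<close>

lemma L2_nn_integral_bound:
  assumes "f \<in> borel_measurable borel" "(\<integral>\<^sup>+x. ennreal ((cmod (f x))\<^sup>2) \<partial>lborel) \<le> ennreal c" "c \<ge> 0"
  shows "f \<in> L2" "(L2_norm f)\<^sup>2 \<le> c"
proof -
  have "integrable lborel (\<lambda>x. (cmod (f x))\<^sup>2)"
    using assms by (intro integrableI_bounded) (auto simp: top_unique le_less_trans)
  with assms(1) show *: "f \<in> L2" by (intro L2_I)
  show "(L2_norm f)\<^sup>2 \<le> c"
    using assms(2,3) L2_norm_nn_integral[OF *] by simp
qed

lemma L2_norm_scale: "L2_norm (\<lambda>x. c * f x) = cmod c * L2_norm f"
  by (simp add: L2_norm_def norm_mult power_mult_distrib real_sqrt_mult)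

lemma L2_norm_minus_commute: "L2_norm (\<lambda>x. f x - g x) = L2_norm (\<lambda>x. g x - f x)"
  by (simp add: L2_norm_def norm_minus_commute)

lemma L2_inner_self: "L2_inner f f = of_real ((L2_norm f)\<^sup>2)"
  by (simp add: L2_inner_def L2_norm_square complex_norm_square[symmetric] del: of_real_power)

lemma L2_inner_commute: "L2_inner g f = cnj (L2_inner f g)"
  unfolding L2_inner_def Bochner_Integration.integral_cnj[symmetric] by (simp add: mult.commute)

lemma L2_inner_diff_left:
  "f \<in> L2 \<Longrightarrow> g \<in> L2 \<Longrightarrow> h \<in> L2 \<Longrightarrow> L2_inner (\<lambda>x. f x - g x) h = L2_inner f h - L2_inner g h"
  by (simp add: L2_inner_def left_diff_distrib L2_integrable_inner)

lemma L2_inner_diff_right: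
  "f \<in> L2 \<Longrightarrow> g \<in> L2 \<Longrightarrow> h \<in> L2 \<Longrightarrow> L2_inner h (\<lambda>x. f x - g x) = L2_inner h f - L2_inner h g"
  by (simp add: L2_inner_def right_diff_distrib L2_integrable_inner)

lemma L2_inner_sum_right:
  "f \<in> L2 \<Longrightarrow> (\<And>i. i \<in> K \<Longrightarrow> x i \<in> L2) \<Longrightarrow>
   L2_inner f (\<lambda>t. \<Sum>i\<in>K. c i * x i t) = (\<Sum>i\<in>K. cnj (c i) * L2_inner f (x i))"
  by (simp add: L2_inner_def sum_distrib_left mult.left_commute[of "f _"] L2_integrable_inner)

lemma L2_norm_diff_square:
  assumes "f \<in> L2" "g \<in> L2"
  shows "(L2_norm (\<lambda>x. f x - g x))\<^sup>2 = (L2_norm f)\<^sup>2 - 2 * Re (L2_inner f g) + (L2_norm g)\<^sup>2"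
proof -
  have "complex_of_real ((L2_norm (\<lambda>x. f x - g x))\<^sup>2)
      = L2_inner f f - L2_inner f g - L2_inner g f + L2_inner g g"
    unfolding L2_inner_self[symmetric] using assms
    by (simp add: L2_inner_diff_left L2_inner_diff_right L2_diff)
  also have "L2_inner g f = cnj (L2_inner f g)" by (rule L2_inner_commute)
  finally have "Re (complex_of_real ((L2_norm (\<lambda>x. f x - g x))\<^sup>2)) =
     Re (of_real ((L2_norm f)\<^sup>2) - L2_inner f g - cnj (L2_inner f g) + of_real ((L2_norm g)\<^sup>2))"
    unfolding L2_inner_self by simp
  then show ?thesis by simp
qed

text \<open>
  This form, with absolute values inside the integral, is what dominates the integrands in Fubini's
  theorem; the inequality for \<open>L2_inner\<close> follows from it.
\<close>

lemma L2_Cauchy_Schwarz_abs: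
  assumes "f \<in> L2" "g \<in> L2"
  shows "(LINT x|lborel. cmod (f x) * cmod (g x)) \<le> L2_norm f * L2_norm g"
proof -
  have m: "f \<in> borel_measurable borel" "g \<in> borel_measurable borel"
    using assms by (auto intro: L2_measurable)
  have i: "integrable lborel (\<lambda>x. cmod (f x) * cmod (g x))"
    using integrable_norm[OF L2_integrable_mult[OF assms]] by (simp add: norm_mult)
  let ?I = "LINT x|lborel. cmod (f x) * cmod (g x)"
  have "(\<integral>\<^sup>+x. ennreal (cmod (f x)) * ennreal (cmod (g x)) \<partial>lborel)\<^sup>2
      \<le> (\<integral>\<^sup>+x. (ennreal (cmod (f x)))\<^sup>2 \<partial>lborel) * (\<integral>\<^sup>+x. (ennreal (cmod (g x)))\<^sup>2 \<partial>lborel)"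
    using m by (intro Cauchy_Schwarz_nn_integral) auto
  also have "(\<integral>\<^sup>+x. ennreal (cmod (f x)) * ennreal (cmod (g x)) \<partial>lborel) = ennreal ?I"
    using nn_integral_eq_integral[OF i] by (simp add: ennreal_mult')
  finally have "(ennreal ?I)\<^sup>2 \<le> ennreal ((L2_norm f)\<^sup>2) * ennreal ((L2_norm g)\<^sup>2)"
    using assms by (simp add: ennreal_power L2_norm_nn_integral)
  then have "ennreal (?I\<^sup>2) \<le> ennreal ((L2_norm f * L2_norm g)\<^sup>2)"
    by (simp add: ennreal_power ennreal_mult' [symmetric] power_mult_distrib)
  then have "?I\<^sup>2 \<le> (L2_norm f * L2_norm g)\<^sup>2"
    by simp
  then show ?thesis
    by (rule power2_le_imp_le) (simp add: L2_norm_nonneg)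
qed

lemma L2_Cauchy_Schwarz:
  assumes "f \<in> L2" "g \<in> L2"
  shows "cmod (L2_inner f g) \<le> L2_norm f * L2_norm g"
proof -
  have "cmod (L2_inner f g) \<le> (LINT x|lborel. cmod (f x * cnj (g x)))"
    unfolding L2_inner_def by (rule integral_norm_bound)
  also have "\<dots> \<le> L2_norm f * L2_norm g"
    using L2_Cauchy_Schwarz_abs[OF assms] by (simp add: norm_mult)
  finally show ?thesis .
qed

lemma L2_norm_triangle_diff:
  assumes "f \<in> L2" "g \<in> L2"
  shows "L2_norm (\<lambda>x. f x - g x) \<le> L2_norm f + L2_norm g"
proof -
  have "- Re (L2_inner f g) \<le> cmod (L2_inner f g)"
    using abs_Re_le_cmod[of "L2_inner f g"] by linarith
  with L2_Cauchy_Schwarz[OF assms] have "- Re (L2_inner f g) \<le> L2_norm f * L2_norm g"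
    by linarith
  then have "(L2_norm (\<lambda>x. f x - g x))\<^sup>2 \<le> (L2_norm f + L2_norm g)\<^sup>2"
    by (simp add: L2_norm_diff_square[OF assms] power2_sum)
  then show ?thesis
    by (rule power2_le_imp_le) (simp add: L2_norm_nonneg)
qed

lemma L2_norm_triangle:
  assumes "f \<in> L2" "g \<in> L2"
  shows "L2_norm (\<lambda>x. f x + g x) \<le> L2_norm f + L2_norm g"
  using L2_norm_triangle_diff[OF assms(1) L2_scale[OF assms(2), of "-1"]]
    L2_norm_scale[of "-1" g] by simp

lemma L2_norm_triangle_via:
  assumes "f \<in> L2" "g \<in> L2" "h \<in> L2"
  shows "L2_norm (\<lambda>x. f x - h x) \<le> L2_norm (\<lambda>x. f x - g x) + L2_norm (\<lambda>x. g x - h x)"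
  using L2_norm_triangle[OF L2_diff[OF assms(1,2)] L2_diff[OF assms(2,3)]] by simp

lemma L2_norm_reverse_triangle:
  assumes "f \<in> L2" "g \<in> L2"
  shows "\<bar>L2_norm f - L2_norm g\<bar> \<le> L2_norm (\<lambda>x. f x - g x)"
  using L2_norm_triangle[OF L2_diff[OF assms] assms(2)]
    L2_norm_triangle[OF L2_diff[OF assms(2,1)] assms(1)]
  by (auto simp: L2_norm_minus_commute[of g f])

lemma L2_norm_sum:
  assumes "\<And>i. i \<in> K \<Longrightarrow> f i \<in> L2"
  shows "L2_norm (\<lambda>x. \<Sum>i\<in>K. f i x) \<le> (\<Sum>i\<in>K. L2_norm (f i))"
  using assms
proof (induction K rule: infinite_finite_induct)
  case (insert i K)
  have "L2_norm (\<lambda>x. \<Sum>i\<in>insert i K. f i x) \<le> L2_norm (f i) + L2_norm (\<lambda>x. \<Sum>i\<in>K. f i x)"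
    using insert by (simp add: L2_norm_triangle L2_sum)
  with insert show ?case by simp
qed (auto simp: L2_norm_def)

lemma L2_translate:
  assumes "f \<in> L2" shows "(\<lambda>x. f (t + x)) \<in> L2"
proof (rule L2_I)
  show "(\<lambda>x. f (t + x)) \<in> borel_measurable borel"
    using L2_measurable[OF assms] by measurable
  show "integrable lborel (\<lambda>x. (cmod (f (t + x)))\<^sup>2)"
    using lborel_integrable_real_affine[OF L2_integrable[OF assms], of 1 t] by simp
qed

lemma L2_norm_translate: "L2_norm (\<lambda>x. f (t + x)) = L2_norm f"
  using lborel_integral_real_affine[of 1 "\<lambda>x. (cmod (f x))\<^sup>2" t] by (simp add: L2_norm_def)

lemma shift_eq_translate: "shift k f = (\<lambda>x. f (- of_int k + x))"
  by (simp add: shift_def)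

lemma L2_shift: "f \<in> L2 \<Longrightarrow> shift k f \<in> L2"
  unfolding shift_eq_translate by (rule L2_translate)

lemma L2_norm_shift: "L2_norm (shift k f) = L2_norm f"
  unfolding shift_eq_translate by (rule L2_norm_translate)

section \<open>Riesz bases and their perturbation\<close>

text \<open>
  The synthesis operator \<open>c \<mapsto> \<Sum>i. c\<^sub>i x\<^sub>i\<close> has squared norm at most \<open>\<beta>\<close>. Arbitrary finite index sets
  take the place of the support of \<open>c\<close>, so that coefficients that happen to vanish need no care.
\<close>

definition synthesis_bound :: "('i \<Rightarrow> real \<Rightarrow> complex) \<Rightarrow> real \<Rightarrow> bool" where
  "synthesis_bound x \<beta> \<longleftrightarrow> \<beta> \<ge> 0 \<and> (\<forall>K c. finite K \<longrightarrow>
     (L2_norm (\<lambda>t. \<Sum>i\<in>K. c i * x i t))\<^sup>2 \<le> \<beta> * (\<Sum>i\<in>K. (cmod (c i))\<^sup>2))"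

lemma synthesis_boundD:
  assumes "synthesis_bound x \<beta>" "finite K"
  shows "L2_norm (\<lambda>t. \<Sum>i\<in>K. c i * x i t) \<le> sqrt \<beta> * sqrt (\<Sum>i\<in>K. (cmod (c i))\<^sup>2)"
proof -
  have "(L2_norm (\<lambda>t. \<Sum>i\<in>K. c i * x i t))\<^sup>2 \<le> \<beta> * (\<Sum>i\<in>K. (cmod (c i))\<^sup>2)"
    using assms by (auto simp: synthesis_bound_def)
  then show ?thesis
    using real_le_rsqrt by (simp add: real_sqrt_mult[symmetric])
qed

lemma riesz_bounds_finite_sum:
  assumes "riesz_bounds x A B" "finite K"
  shows "A * (\<Sum>i\<in>K. (cmod (c i))\<^sup>2) \<le> (L2_norm (\<lambda>t. \<Sum>i\<in>K. c i * x i t))\<^sup>2"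
    and "(L2_norm (\<lambda>t. \<Sum>i\<in>K. c i * x i t))\<^sup>2 \<le> B * (\<Sum>i\<in>K. (cmod (c i))\<^sup>2)"
proof -
  define d where "d i = (if i \<in> K then c i else 0)" for i
  have sub: "{i. d i \<noteq> 0} \<subseteq> K" by (auto simp: d_def)
  have fin: "finite {i. d i \<noteq> 0}" using sub assms(2) finite_subset by blast
  have "(\<Sum>i | d i \<noteq> 0. (cmod (d i))\<^sup>2) = (\<Sum>i\<in>K. (cmod (d i))\<^sup>2)"
    using assms(2) sub by (intro sum.mono_neutral_left) auto
  also have "\<dots> = (\<Sum>i\<in>K. (cmod (c i))\<^sup>2)" by (simp add: d_def)
  finally have 1: "(\<Sum>i | d i \<noteq> 0. (cmod (d i))\<^sup>2) = (\<Sum>i\<in>K. (cmod (c i))\<^sup>2)" .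
  have "(\<Sum>i | d i \<noteq> 0. d i * x i t) = (\<Sum>i\<in>K. d i * x i t)" for t
    using assms(2) sub by (intro sum.mono_neutral_left) auto
  also have "\<dots> t = (\<Sum>i\<in>K. c i * x i t)" for t by (simp add: d_def)
  finally have 2: "(\<lambda>t. \<Sum>i | d i \<noteq> 0. d i * x i t) = (\<lambda>t. \<Sum>i\<in>K. c i * x i t)" by simp
  from assms(1) fin have
    "A * (\<Sum>i | d i \<noteq> 0. (cmod (d i))\<^sup>2) \<le> (L2_norm (\<lambda>t. \<Sum>i | d i \<noteq> 0. d i * x i t))\<^sup>2 \<and>
     (L2_norm (\<lambda>t. \<Sum>i | d i \<noteq> 0. d i * x i t))\<^sup>2 \<le> B * (\<Sum>i | d i \<noteq> 0. (cmod (d i))\<^sup>2)"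
    unfolding riesz_bounds_def by blast
  then show "A * (\<Sum>i\<in>K. (cmod (c i))\<^sup>2) \<le> (L2_norm (\<lambda>t. \<Sum>i\<in>K. c i * x i t))\<^sup>2"
    and "(L2_norm (\<lambda>t. \<Sum>i\<in>K. c i * x i t))\<^sup>2 \<le> B * (\<Sum>i\<in>K. (cmod (c i))\<^sup>2)"
    unfolding 1 2 by auto
qed

lemma riesz_bounds_synthesis_bound:
  assumes "riesz_bounds x A B" shows "synthesis_bound x B"
  unfolding synthesis_bound_def
proof (intro conjI allI impI)
  show "0 \<le> B" using assms by (simp add: riesz_bounds_def)
qed (rule riesz_bounds_finite_sum(2)[OF assms])

lemma synthesis_bound_mono:
  assumes "synthesis_bound x \<beta>" "\<beta> \<le> \<beta>'" shows "synthesis_bound x \<beta>'"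
  using assms unfolding synthesis_bound_def
  by (auto intro!: order_trans[OF _ mult_right_mono[OF assms(2)]] sum_nonneg)

text \<open>
  The analysis operator \<open>f \<mapsto> (\<langle>f, x\<^sub>i\<rangle>)\<^sub>i\<close> is the adjoint of the synthesis operator and has the same norm:
  pair \<open>f\<close> with the synthesis of its own coefficients.
\<close>

lemma bessel_inequality:
  assumes "synthesis_bound x \<beta>" "\<And>i. x i \<in> L2" "f \<in> L2" "finite K"
  shows "(\<Sum>i\<in>K. (cmod (L2_inner f (x i)))\<^sup>2) \<le> \<beta> * (L2_norm f)\<^sup>2"
proof -
  define c where "c i = L2_inner f (x i)" for i
  define p where "p = (\<lambda>t. \<Sum>i\<in>K. c i * x i t)"
  define s where "s = (\<Sum>i\<in>K. (cmod (c i))\<^sup>2)"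
  have p: "p \<in> L2" unfolding p_def by (intro L2_sum L2_scale assms(2))
  have s0: "s \<ge> 0" unfolding s_def by (simp add: sum_nonneg)
  have "L2_inner f p = of_real s"
    unfolding p_def s_def using assms
    by (simp add: L2_inner_sum_right c_def[symmetric] complex_norm_square mult.commute
        del: of_real_power)
  then have "s \<le> L2_norm f * L2_norm p"
    using L2_Cauchy_Schwarz[OF assms(3) p] s0 by simp
  then have "s\<^sup>2 \<le> (L2_norm f * L2_norm p)\<^sup>2"
    using s0 by (rule power_mono)
  also have "\<dots> \<le> (L2_norm f)\<^sup>2 * (\<beta> * s)"
    using assms(1,4) unfolding power_mult_distrib p_def s_def synthesis_bound_def
    by (intro mult_left_mono) auto
  finally have "s * s \<le> (\<beta> * (L2_norm f)\<^sup>2) * s" by (simp add: power2_eq_square mult_ac)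
  then have "s \<le> \<beta> * (L2_norm f)\<^sup>2"
    using s0 assms(1) by (cases "s = 0") (auto simp: synthesis_bound_def)
  then show ?thesis by (simp add: s_def c_def)
qed

lemma closed_L2_subspace_L2: "closed_L2_subspace V \<Longrightarrow> f \<in> V \<Longrightarrow> f \<in> L2"
  by (auto simp: closed_L2_subspace_def)

lemma closed_L2_subspace_add:
    "closed_L2_subspace V \<Longrightarrow> f \<in> V \<Longrightarrow> g \<in> V \<Longrightarrow> (\<lambda>x. f x + g x) \<in> V"
  and closed_L2_subspace_scale: "closed_L2_subspace V \<Longrightarrow> f \<in> V \<Longrightarrow> (\<lambda>x. c * f x) \<in> V"
  unfolding closed_L2_subspace_def by simp_all

lemma closed_L2_subspace_diff:
  assumes "closed_L2_subspace V" "f \<in> V" "g \<in> V"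
  shows "(\<lambda>x. f x - g x) \<in> V"
  using closed_L2_subspace_add[OF assms(1,2) closed_L2_subspace_scale[OF assms(1,3), of "-1"]] by simp

lemma closed_L2_subspace_sum:
  assumes "closed_L2_subspace V" "\<And>i. i \<in> K \<Longrightarrow> x i \<in> V"
  shows "(\<lambda>t. \<Sum>i\<in>K. c i * x i t) \<in> V"
  using assms(2)
proof (induction K rule: infinite_finite_induct)
  case (insert i K)
  then have "(\<lambda>t. \<Sum>i\<in>K. c i * x i t) \<in> V" "x i \<in> V" by auto
  then have "(\<lambda>t. c i * x i t + (\<Sum>i\<in>K. c i * x i t)) \<in> V"
    by (intro closed_L2_subspace_add closed_L2_subspace_scale assms(1))
  with insert show ?case by simp
qed (use assms(1) in \<open>auto simp: closed_L2_subspace_def\<close>)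

text \<open>
  A relaxed step of the frame algorithm. For \<open>p = (1/\<beta>) \<Sum>i\<in>K. \<langle>f, x\<^sub>i\<rangle> x\<^sub>i\<close> and
  \<open>s = \<Sum>i\<in>K. |\<langle>f, x\<^sub>i\<rangle>|\<^sup>2\<close> one has \<open>\<langle>f, p\<rangle> = s/\<beta>\<close> and \<open>\<parallel>p\<parallel>\<^sup>2 \<le> s/\<beta>\<close>, hence
  \<open>\<parallel>f - p\<parallel>\<^sup>2 \<le> \<parallel>f\<parallel>\<^sup>2 - s/\<beta>\<close>. A finite \<open>K\<close> that captures half of the lower frame bound already makes
  this a strict contraction.
\<close>

lemma frame_contraction_step:
  assumes V: "closed_L2_subspace V" and x: "\<And>i. x i \<in> V"
    and \<beta>: "synthesis_bound x \<beta>" "0 < \<beta>"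
    and lower: "0 < a" "(\<lambda>i. (cmod (L2_inner f (x i)))\<^sup>2) summable_on UNIV"
      "a * (L2_norm f)\<^sup>2 \<le> (\<Sum>\<^sub>\<infinity>i. (cmod (L2_inner f (x i)))\<^sup>2)"
    and f: "f \<in> V"
  obtains K c where "finite K"
    "(L2_norm (\<lambda>t. f t - (\<Sum>i\<in>K. c i * x i t)))\<^sup>2 \<le> (1 - a / (2 * \<beta>)) * (L2_norm f)\<^sup>2"
proof -
  let ?e = "\<lambda>i. L2_inner f (x i)"
  have xL: "x i \<in> L2" and fL: "f \<in> L2" for i using V x f closed_L2_subspace_L2 by auto
  have "\<exists>K. finite K \<and> a / 2 * (L2_norm f)\<^sup>2 \<le> (\<Sum>i\<in>K. (cmod (?e i))\<^sup>2)"
  proof (cases "L2_norm f = 0")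
    case False
    then have "0 < a * (L2_norm f)\<^sup>2" using lower(1) by simp
    then have "a / 2 * (L2_norm f)\<^sup>2 < (\<Sum>\<^sub>\<infinity>i. (cmod (?e i))\<^sup>2)"
      using lower(3) by linarith
    also have "(\<Sum>\<^sub>\<infinity>i. (cmod (?e i))\<^sup>2) = (SUP K\<in>{K. finite K \<and> K \<subseteq> UNIV}. \<Sum>i\<in>K. (cmod (?e i))\<^sup>2)"
      using lower(2) by (intro infsum_nonneg_is_SUPREMUM_real) auto
    finally have lt: "a / 2 * (L2_norm f)\<^sup>2 < (SUP K\<in>{K. finite K \<and> K \<subseteq> UNIV}. \<Sum>i\<in>K. (cmod (?e i))\<^sup>2)" .
    have "\<exists>K\<in>{K. finite K \<and> K \<subseteq> UNIV}. a / 2 * (L2_norm f)\<^sup>2 < (\<Sum>i\<in>K. (cmod (?e i))\<^sup>2)"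
    proof (rule ccontr)
      assume "\<not> ?thesis"
      then have "(SUP K\<in>{K. finite K \<and> K \<subseteq> UNIV}. \<Sum>i\<in>K. (cmod (?e i))\<^sup>2) \<le> a / 2 * (L2_norm f)\<^sup>2"
        by (intro cSUP_least) (auto simp: not_less)
      with lt show False by linarith
    qed
    then show ?thesis by (auto intro: less_imp_le)
  qed auto
  then obtain K where K: "finite K" "a / 2 * (L2_norm f)\<^sup>2 \<le> (\<Sum>i\<in>K. (cmod (?e i))\<^sup>2)" by blast
  define s where "s = (\<Sum>i\<in>K. (cmod (?e i))\<^sup>2)"
  define c where "c i = of_real (1 / \<beta>) * ?e i" for i
  define p where "p = (\<lambda>t. \<Sum>i\<in>K. c i * x i t)"
  have p: "p \<in> L2" unfolding p_def by (intro L2_sum L2_scale xL)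
  have "L2_inner f p = (\<Sum>i\<in>K. of_real (1 / \<beta>) * of_real ((cmod (?e i))\<^sup>2))"
    unfolding p_def L2_inner_sum_right[OF fL xL] complex_norm_square
    by (simp add: c_def mult.commute)
  also have "\<dots> = of_real (s / \<beta>)"
    by (simp add: s_def sum_divide_distrib)
  finally have 1: "Re (L2_inner f p) = s / \<beta>" by simp
  have "(L2_norm p)\<^sup>2 \<le> \<beta> * (\<Sum>i\<in>K. (cmod (c i))\<^sup>2)"
    using \<beta> K unfolding p_def synthesis_bound_def by blast
  also have "(\<Sum>i\<in>K. (cmod (c i))\<^sup>2) = (1/\<beta>)\<^sup>2 * s"
    by (simp add: c_def s_def norm_mult norm_divide power_mult_distrib power_divide sum_distrib_left \<open>0 < \<beta>\<close>)
  also have "\<beta> * ((1/\<beta>)\<^sup>2 * s) = s / \<beta>"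
    using \<beta>(2) by (simp add: power2_eq_square)
  finally have "(L2_norm (\<lambda>t. f t - p t))\<^sup>2 \<le> (L2_norm f)\<^sup>2 - s / \<beta>"
    using L2_norm_diff_square[OF fL p] 1 by linarith
  also have "\<dots> \<le> (1 - a / (2 * \<beta>)) * (L2_norm f)\<^sup>2"
    using K(2) \<beta>(2) unfolding s_def[symmetric] by (simp add: field_simps)
  finally show ?thesis using K(1) by (intro that[of K c]) (simp_all add: p_def)
qed

text \<open>
  Each residual \<open>f - p\<close> lies in \<open>V\<close> again, so the contraction step can be iterated; finite
  combinations stay finite.
\<close>

lemma frame_span_dense:
  assumes V: "closed_L2_subspace V" and fr: "frame_of V x" and \<beta>: "synthesis_bound x \<beta>"
    and f: "f \<in> V" and "0 < \<epsilon>"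
  obtains K c where "finite K" "L2_norm (\<lambda>t. f t - (\<Sum>i\<in>K. c i * x i t)) < \<epsilon>"
proof -
  have x: "x i \<in> V" for i using fr by (simp add: frame_of_def)
  from fr obtain a where a: "0 < a" "\<And>f. f \<in> V \<Longrightarrow> (\<lambda>i. (cmod (L2_inner f (x i)))\<^sup>2) summable_on UNIV"
      "\<And>f. f \<in> V \<Longrightarrow> a * (L2_norm f)\<^sup>2 \<le> (\<Sum>\<^sub>\<infinity>i. (cmod (L2_inner f (x i)))\<^sup>2)"
    unfolding frame_of_def by blast
  \<comment> \<open>a larger synthesis bound keeps the contraction factor nonnegative\<close>
  define b where "b = max a \<beta>"
  have b: "synthesis_bound x b" "0 < b"
    using synthesis_bound_mono[OF \<beta>, of b] a(1) by (auto simp: b_def)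
  define q where "q = 1 - a / (2 * b)"
  have "a \<le> 2 * b" "0 < a / (2 * b)" using a(1) b(2) by (auto simp: b_def)
  then have q: "0 \<le> q" "q < 1" using b(2) by (auto simp: q_def field_simps)
  have approx: "\<exists>K c. finite K \<and> (L2_norm (\<lambda>t. f t - (\<Sum>i\<in>K. c i * x i t)))\<^sup>2 \<le> q ^ n * (L2_norm f)\<^sup>2" for n
  proof (induction n)
    case 0
    show ?case by (intro exI[of _ "{}"]) auto
  next
    case (Suc n)
    then obtain K c where K: "finite K"
      "(L2_norm (\<lambda>t. f t - (\<Sum>i\<in>K. c i * x i t)))\<^sup>2 \<le> q ^ n * (L2_norm f)\<^sup>2" by blast
    define g where "g = (\<lambda>t. f t - (\<Sum>i\<in>K. c i * x i t))"
    have g: "g \<in> V" unfolding g_def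
      by (intro closed_L2_subspace_diff closed_L2_subspace_sum V f x)
    obtain K' c' where K': "finite K'"
      "(L2_norm (\<lambda>t. g t - (\<Sum>i\<in>K'. c' i * x i t)))\<^sup>2 \<le> q * (L2_norm g)\<^sup>2"
      using frame_contraction_step[OF V x b a(1) a(2)[OF g] a(3)[OF g] g] unfolding q_def by blast
    define d where "d i = (if i \<in> K then c i else 0) + (if i \<in> K' then c' i else 0)" for i
    have "(\<Sum>i\<in>K \<union> K'. d i * x i t) = (\<Sum>i\<in>K. c i * x i t) + (\<Sum>i\<in>K'. c' i * x i t)" for t
    proof -
      have "(\<Sum>i\<in>K. c i * x i t) = (\<Sum>i\<in>K \<union> K'. (if i \<in> K then c i else 0) * x i t)"
        using K(1) K'(1) by (intro sum.mono_neutral_cong_left) auto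
      moreover have "(\<Sum>i\<in>K'. c' i * x i t) = (\<Sum>i\<in>K \<union> K'. (if i \<in> K' then c' i else 0) * x i t)"
        using K(1) K'(1) by (intro sum.mono_neutral_cong_left) auto
      ultimately show ?thesis by (simp add: d_def distrib_right sum.distrib)
    qed
    then have "(\<lambda>t. f t - (\<Sum>i\<in>K \<union> K'. d i * x i t)) = (\<lambda>t. g t - (\<Sum>i\<in>K'. c' i * x i t))"
      by (auto simp: g_def)
    moreover have "q * (L2_norm g)\<^sup>2 \<le> q ^ Suc n * (L2_norm f)\<^sup>2"
      using K(2) q(1) by (simp add: g_def mult.assoc mult_left_mono)
    ultimately show ?case using K(1) K'
      by (intro exI[of _ "K \<union> K'"] exI[of _ d]) auto
  qed
  have "(\<lambda>n. q ^ n * (L2_norm f)\<^sup>2) \<longlonglongrightarrow> 0 * (L2_norm f)\<^sup>2"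
    using q by (intro tendsto_mult tendsto_const LIMSEQ_power_zero) auto
  then have "eventually (\<lambda>n. q ^ n * (L2_norm f)\<^sup>2 < \<epsilon>\<^sup>2) sequentially"
    using \<open>0 < \<epsilon>\<close> by (intro order_tendstoD(2)[of _ "0 * (L2_norm f)\<^sup>2"]) auto
  then obtain n where n: "q ^ n * (L2_norm f)\<^sup>2 < \<epsilon>\<^sup>2"
    by (auto simp: eventually_sequentially)
  from approx[of n] obtain K c where "finite K"
      "(L2_norm (\<lambda>t. f t - (\<Sum>i\<in>K. c i * x i t)))\<^sup>2 < \<epsilon>\<^sup>2"
    using n by (auto intro: le_less_trans)
  then show ?thesis
    using \<open>0 < \<epsilon>\<close> power_less_imp_less_base[of _ 2 \<epsilon>] by (intro that[of K c]) auto
qed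

lemma sqrt_sum_squares_le_infsum:
  assumes "(\<lambda>i. (cmod (e i))\<^sup>2) summable_on UNIV" "finite K"
  shows "L2_set (\<lambda>i. cmod (e i)) K \<le> sqrt (\<Sum>\<^sub>\<infinity>i. (cmod (e i))\<^sup>2)"
  unfolding L2_set_def using assms
  by (intro real_sqrt_le_mono finite_sum_le_infsum) auto

text \<open>
  Minkowski's inequality in \<open>\<ell>\<^sup>2(K)\<close>: coefficient sequences that differ by a sequence of norm at
  most \<open>\<surd>\<delta>\<close> have norms that differ by at most \<open>\<surd>\<delta>\<close>.
\<close>

lemma L2_set_inner_diff_le:
  assumes "finite K" "\<And>i. cmod (e i) \<le> cmod (e' i) + cmod (d i)"
    "(\<Sum>i\<in>K. (cmod (d i))\<^sup>2) \<le> \<delta>"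
  shows "L2_set (\<lambda>i. cmod (e i)) K \<le> L2_set (\<lambda>i. cmod (e' i)) K + sqrt \<delta>"
proof -
  have "L2_set (\<lambda>i. cmod (e i)) K \<le> L2_set (\<lambda>i. cmod (e' i) + cmod (d i)) K"
    using assms(2) by (intro L2_set_mono) auto
  also have "\<dots> \<le> L2_set (\<lambda>i. cmod (e' i)) K + L2_set (\<lambda>i. cmod (d i)) K"
    by (rule L2_set_triangle_ineq)
  also have "L2_set (\<lambda>i. cmod (d i)) K \<le> sqrt \<delta>"
    unfolding L2_set_def using assms(3) by (intro real_sqrt_le_mono)
  finally show ?thesis by simp
qed

text \<open>
  For a finite combination \<open>p = \<Sum>i\<in>K. c\<^sub>i x\<^sub>i\<close>, expanding one factor of \<open>\<langle>p, p\<rangle>\<close> gives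
  \<open>\<parallel>p\<parallel>\<^sup>2 \<le> \<parallel>c\<parallel> (\<Sum>i\<in>K. |\<langle>p, x\<^sub>i\<rangle>|\<^sup>2)\<^bsup>1/2\<^esup>\<close>, while the lower Riesz bound gives \<open>\<surd>A \<parallel>c\<parallel> \<le> \<parallel>p\<parallel>\<close>.
  Dividing by \<open>\<parallel>p\<parallel>\<close> proves the claim for \<open>p\<close>; density of the span and Bessel's inequality carry it to
  all of \<open>V\<close>.
\<close>

lemma riesz_lower_bound_is_frame_bound:
  assumes V: "closed_L2_subspace V" and fr: "frame_of V x" and rb: "riesz_bounds x A B"
    and f: "f \<in> V"
  shows "sqrt A * L2_norm f \<le> sqrt (\<Sum>\<^sub>\<infinity>i. (cmod (L2_inner f (x i)))\<^sup>2)"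
proof (rule field_le_epsilon)
  fix \<eta> :: real assume "0 < \<eta>"
  have xL: "x i \<in> L2" and fL: "f \<in> L2" for i
    using V f fr closed_L2_subspace_L2 by (auto simp: frame_of_def)
  have AB: "0 < A" "0 < B" using rb by (auto simp: riesz_bounds_def)
  define S where "S = sqrt (\<Sum>\<^sub>\<infinity>i. (cmod (L2_inner f (x i)))\<^sup>2)"
  \<comment> \<open>replacing \<open>f\<close> by \<open>p\<close> costs \<open>\<surd>A \<epsilon>\<close> on the left and, by Bessel, \<open>\<surd>B \<epsilon>\<close> on the right\<close>
  define \<epsilon> where "\<epsilon> = \<eta> / (sqrt A + sqrt B)"
  have sAB: "0 < sqrt A + sqrt B" using AB by (simp add: add_pos_pos)
  have \<epsilon>: "0 < \<epsilon>" using \<open>0 < \<eta>\<close> sAB by (simp add: \<epsilon>_def)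
  note sb = riesz_bounds_synthesis_bound[OF rb]
  obtain K c where K: "finite K" "L2_norm (\<lambda>t. f t - (\<Sum>i\<in>K. c i * x i t)) < \<epsilon>"
    using frame_span_dense[OF V fr sb f \<epsilon>] by blast
  define p where "p = (\<lambda>t. \<Sum>i\<in>K. c i * x i t)"
  have p: "p \<in> L2" unfolding p_def by (intro L2_sum L2_scale xL)
  define s where "s = (\<Sum>i\<in>K. (cmod (c i))\<^sup>2)"
  have "cmod (L2_inner p p) = cmod (\<Sum>i\<in>K. cnj (c i) * L2_inner p (x i))"
    using p xL by (subst (2) p_def) (simp add: L2_inner_sum_right)
  also have "\<dots> \<le> (\<Sum>i\<in>K. \<bar>cmod (c i)\<bar> * \<bar>cmod (L2_inner p (x i))\<bar>)"
    by (rule order_trans[OF norm_sum]) (simp add: norm_mult)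
  also have "\<dots> \<le> L2_set (\<lambda>i. cmod (c i)) K * L2_set (\<lambda>i. cmod (L2_inner p (x i))) K"
    by (rule L2_set_mult_ineq)
  finally have 1: "(L2_norm p)\<^sup>2 \<le> sqrt s * L2_set (\<lambda>i. cmod (L2_inner p (x i))) K"
    unfolding L2_inner_self by (simp add: s_def L2_set_def del: of_real_power)
  have 2: "sqrt A * sqrt s \<le> L2_norm p"
    using riesz_bounds_finite_sum(1)[OF rb K(1), of c] L2_norm_nonneg
    by (simp add: s_def p_def real_sqrt_mult[symmetric] real_le_lsqrt)
  have "sqrt A * L2_norm p \<le> L2_set (\<lambda>i. cmod (L2_inner p (x i))) K"
  proof (cases "L2_norm p = 0")
    case True
    then show ?thesis by (simp add: L2_set_nonneg)
  next
    case False
    then have pos: "0 < L2_norm p" using L2_norm_nonneg[of p] by simp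
    have "L2_norm p * (sqrt A * L2_norm p) = sqrt A * (L2_norm p)\<^sup>2" by (simp add: power2_eq_square)
    also have "\<dots> \<le> sqrt A * (sqrt s * L2_set (\<lambda>i. cmod (L2_inner p (x i))) K)"
      using 1 AB by (intro mult_left_mono) auto
    also have "\<dots> = (sqrt A * sqrt s) * L2_set (\<lambda>i. cmod (L2_inner p (x i))) K" by simp
    also have "\<dots> \<le> L2_norm p * L2_set (\<lambda>i. cmod (L2_inner p (x i))) K"
      by (intro mult_right_mono 2 L2_set_nonneg)
    finally show ?thesis using pos by simp
  qed
  also have "L2_set (\<lambda>i. cmod (L2_inner p (x i))) K
    \<le> L2_set (\<lambda>i. cmod (L2_inner f (x i))) K + sqrt (B * (L2_norm (\<lambda>t. f t - p t))\<^sup>2)"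
  proof (rule L2_set_inner_diff_le[OF K(1)])
    show "cmod (L2_inner p (x i)) \<le> cmod (L2_inner f (x i)) + cmod (L2_inner (\<lambda>t. f t - p t) (x i))" for i
      unfolding L2_inner_diff_left[OF fL p xL]
      by (metis norm_triangle_sub add.commute norm_minus_commute)
    show "(\<Sum>i\<in>K. (cmod (L2_inner (\<lambda>t. f t - p t) (x i)))\<^sup>2) \<le> B * (L2_norm (\<lambda>t. f t - p t))\<^sup>2"
      by (intro bessel_inequality sb xL L2_diff fL p K(1))
  qed
  also have "L2_set (\<lambda>i. cmod (L2_inner f (x i))) K \<le> S"
    unfolding S_def using fr f K(1) by (intro sqrt_sum_squares_le_infsum) (auto simp: frame_of_def)
  also have "sqrt (B * (L2_norm (\<lambda>t. f t - p t))\<^sup>2) \<le> sqrt B * \<epsilon>"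
    using K(2) AB L2_norm_nonneg[of "\<lambda>t. f t - p t"] by (simp add: real_sqrt_mult p_def)
  finally have "sqrt A * L2_norm p \<le> S + sqrt B * \<epsilon>" by simp
  moreover have "L2_norm f \<le> L2_norm p + \<epsilon>"
    using L2_norm_reverse_triangle[OF fL p] K(2) by (simp add: p_def)
  then have "sqrt A * L2_norm f \<le> sqrt A * (L2_norm p + \<epsilon>)"
    using AB by (intro mult_left_mono) auto
  moreover have "(sqrt A + sqrt B) * \<epsilon> = \<eta>" using sAB by (simp add: \<epsilon>_def)
  ultimately show "sqrt A * L2_norm f \<le> S + \<eta>" by (simp add: algebra_simps)
qed

text \<open>
  Both operators attached to \<open>y\<close> differ from those of \<open>x\<close> by operators of norm at most \<open>\<surd>\<mu>\<close>: the
  synthesis operators by hypothesis, the analysis operators by Bessel's inequality for \<open>x - y\<close>. As the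
  operators of \<open>x\<close> are bounded below by \<open>\<surd>A > \<surd>\<mu>\<close>, those of \<open>y\<close> are bounded below by
  \<open>\<surd>A - \<surd>\<mu>\<close>.
\<close>

theorem riesz_basis_perturbation:
  assumes V: "closed_L2_subspace V" and fr: "frame_of V x" and rb: "riesz_bounds x A B"
    and y: "\<And>i. y i \<in> V"
    and pert: "synthesis_bound (\<lambda>i t. x i t - y i t) \<mu>" and "\<mu> < A"
  shows "riesz_basis V y"
proof -
  have xV: "x i \<in> V" for i using fr by (simp add: frame_of_def)
  have xL: "x i \<in> L2" and yL: "y i \<in> L2" for i
    using V y xV closed_L2_subspace_L2 by auto
  have dL: "(\<lambda>t. x i t - y i t) \<in> L2" for i by (intro L2_diff xL yL)
  have AB: "0 < A" "0 < B" using rb by (auto simp: riesz_bounds_def)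
  have \<mu>: "0 \<le> \<mu>" using pert by (simp add: synthesis_bound_def)
  define a where "a = sqrt A - sqrt \<mu>"
  define b where "b = sqrt B + sqrt \<mu>"
  have a: "0 < a" using \<open>\<mu> < A\<close> by (simp add: a_def)
  have b: "0 < b" using AB \<mu> by (simp add: b_def add_pos_nonneg)
  note sb = riesz_bounds_synthesis_bound[OF rb]
  have main: "a * sqrt (\<Sum>i\<in>K. (cmod (c i))\<^sup>2) \<le> L2_norm (\<lambda>t. \<Sum>i\<in>K. c i * y i t) \<and>
     L2_norm (\<lambda>t. \<Sum>i\<in>K. c i * y i t) \<le> b * sqrt (\<Sum>i\<in>K. (cmod (c i))\<^sup>2)" if K: "finite K" for K c
  proof -
    define X where "X = (\<lambda>t. \<Sum>i\<in>K. c i * x i t)"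
    define Y where "Y = (\<lambda>t. \<Sum>i\<in>K. c i * y i t)"
    define s where "s = sqrt (\<Sum>i\<in>K. (cmod (c i))\<^sup>2)"
    have X: "X \<in> L2" and Y: "Y \<in> L2"
      unfolding X_def Y_def by (intro L2_sum L2_scale xL yL)+
    have "(\<lambda>t. X t - Y t) = (\<lambda>t. \<Sum>i\<in>K. c i * (x i t - y i t))"
      by (simp add: X_def Y_def right_diff_distrib sum_subtractf)
    then have "L2_norm (\<lambda>t. X t - Y t) \<le> sqrt \<mu> * s"
      using synthesis_boundD[OF pert K, of c] by (simp add: s_def)
    then have "\<bar>L2_norm X - L2_norm Y\<bar> \<le> sqrt \<mu> * s"
      using L2_norm_reverse_triangle[OF X Y] by linarith
    moreover have "L2_norm X \<le> sqrt B * s"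
      using synthesis_boundD[OF sb K, of c] by (simp add: X_def s_def)
    moreover have "sqrt A * s \<le> L2_norm X"
      using riesz_bounds_finite_sum(1)[OF rb K, of c] L2_norm_nonneg
      by (simp add: s_def X_def real_sqrt_mult[symmetric] real_le_lsqrt)
    ultimately show ?thesis unfolding a_def b_def X_def[symmetric] Y_def[symmetric] s_def[symmetric]
      by (auto simp: algebra_simps)
  qed
  have nn: "0 \<le> (\<Sum>i\<in>K. (cmod (c i))\<^sup>2)" for K and c :: "_ \<Rightarrow> complex" by (simp add: sum_nonneg)
  have main2: "a\<^sup>2 * (\<Sum>i\<in>K. (cmod (c i))\<^sup>2) \<le> (L2_norm (\<lambda>t. \<Sum>i\<in>K. c i * y i t))\<^sup>2 \<and>
     (L2_norm (\<lambda>t. \<Sum>i\<in>K. c i * y i t))\<^sup>2 \<le> b\<^sup>2 * (\<Sum>i\<in>K. (cmod (c i))\<^sup>2)" if K: "finite K" for K c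
  proof -
    have "(a * sqrt (\<Sum>i\<in>K. (cmod (c i))\<^sup>2))\<^sup>2 \<le> (L2_norm (\<lambda>t. \<Sum>i\<in>K. c i * y i t))\<^sup>2"
      using main[OF K, of c] a nn[of c K] by (intro power_mono) auto
    moreover have "(L2_norm (\<lambda>t. \<Sum>i\<in>K. c i * y i t))\<^sup>2 \<le> (b * sqrt (\<Sum>i\<in>K. (cmod (c i))\<^sup>2))\<^sup>2"
      using main[OF K, of c] L2_norm_nonneg by (intro power_mono) auto
    ultimately show ?thesis using nn[of c K] by (simp add: power_mult_distrib)
  qed
  have ry: "riesz_bounds y (a\<^sup>2) (b\<^sup>2)"
    unfolding riesz_bounds_def using main2 a b by auto
  have sby: "synthesis_bound y (b\<^sup>2)" by (rule riesz_bounds_synthesis_bound[OF ry])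
  have frame: "(\<lambda>i. (cmod (L2_inner f (y i)))\<^sup>2) summable_on UNIV \<and>
      a\<^sup>2 * (L2_norm f)\<^sup>2 \<le> (\<Sum>\<^sub>\<infinity>i. (cmod (L2_inner f (y i)))\<^sup>2) \<and>
      (\<Sum>\<^sub>\<infinity>i. (cmod (L2_inner f (y i)))\<^sup>2) \<le> b\<^sup>2 * (L2_norm f)\<^sup>2" if f: "f \<in> V" for f
  proof (intro conjI)
    have fL: "f \<in> L2" using V f closed_L2_subspace_L2 by auto
    have bes: "(\<Sum>i\<in>K. (cmod (L2_inner f (y i)))\<^sup>2) \<le> b\<^sup>2 * (L2_norm f)\<^sup>2" if "finite K" for K
      by (intro bessel_inequality sby yL fL that)
    show sum: "(\<lambda>i. (cmod (L2_inner f (y i)))\<^sup>2) summable_on UNIV"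
      by (intro nonneg_bdd_above_summable_on bdd_aboveI[of _ "b\<^sup>2 * (L2_norm f)\<^sup>2"]) (auto intro: bes)
    show "(\<Sum>\<^sub>\<infinity>i. (cmod (L2_inner f (y i)))\<^sup>2) \<le> b\<^sup>2 * (L2_norm f)\<^sup>2"
      by (intro infsum_le_finite_sums sum bes)
    define S where "S = sqrt (\<Sum>\<^sub>\<infinity>i. (cmod (L2_inner f (y i)))\<^sup>2)"
    have S0: "0 \<le> S" unfolding S_def by (intro real_sqrt_ge_zero infsum_nonneg) auto
    have part: "(\<Sum>i\<in>K. (cmod (L2_inner f (x i)))\<^sup>2) \<le> (S + sqrt \<mu> * L2_norm f)\<^sup>2" if K: "finite K" for K
    proof -
      have "L2_set (\<lambda>i. cmod (L2_inner f (x i))) K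
        \<le> L2_set (\<lambda>i. cmod (L2_inner f (y i))) K + sqrt (\<mu> * (L2_norm f)\<^sup>2)"
      proof (rule L2_set_inner_diff_le[OF K])
        show "cmod (L2_inner f (x i)) \<le> cmod (L2_inner f (y i)) + cmod (L2_inner f (\<lambda>t. x i t - y i t))" for i
          unfolding L2_inner_diff_right[OF xL yL fL] by (metis norm_triangle_sub)
        show "(\<Sum>i\<in>K. (cmod (L2_inner f (\<lambda>t. x i t - y i t)))\<^sup>2) \<le> \<mu> * (L2_norm f)\<^sup>2"
          by (intro bessel_inequality[OF pert] dL fL K)
      qed
      also have "L2_set (\<lambda>i. cmod (L2_inner f (y i))) K \<le> S"
        unfolding S_def by (intro sqrt_sum_squares_le_infsum sum K)
      also have "sqrt (\<mu> * (L2_norm f)\<^sup>2) = sqrt \<mu> * L2_norm f"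
        by (simp add: real_sqrt_mult L2_norm_nonneg)
      finally have "L2_set (\<lambda>i. cmod (L2_inner f (x i))) K \<le> S + sqrt \<mu> * L2_norm f" by simp
      then have "(L2_set (\<lambda>i. cmod (L2_inner f (x i))) K)\<^sup>2 \<le> (S + sqrt \<mu> * L2_norm f)\<^sup>2"
        by (intro power_mono L2_set_nonneg)
      then show ?thesis by (simp add: L2_set_def nn)
    qed
    have "(\<Sum>\<^sub>\<infinity>i. (cmod (L2_inner f (x i)))\<^sup>2) \<le> (S + sqrt \<mu> * L2_norm f)\<^sup>2"
      using fr f by (intro infsum_le_finite_sums part) (auto simp: frame_of_def)
    then have "sqrt (\<Sum>\<^sub>\<infinity>i. (cmod (L2_inner f (x i)))\<^sup>2) \<le> S + sqrt \<mu> * L2_norm f"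
      using S0 \<mu> L2_norm_nonneg[of f] by (intro real_le_lsqrt) auto
    with riesz_lower_bound_is_frame_bound[OF V fr rb f] have "a * L2_norm f \<le> S"
      by (simp add: a_def algebra_simps)
    then have "(a * L2_norm f)\<^sup>2 \<le> S\<^sup>2" using a L2_norm_nonneg[of f] by (intro power_mono) auto
    also have "S\<^sup>2 = (\<Sum>\<^sub>\<infinity>i. (cmod (L2_inner f (y i)))\<^sup>2)"
      unfolding S_def by (intro real_sqrt_pow2 infsum_nonneg) auto
    finally show "a\<^sup>2 * (L2_norm f)\<^sup>2 \<le> (\<Sum>\<^sub>\<infinity>i. (cmod (L2_inner f (y i)))\<^sup>2)"
      by (simp add: power_mult_distrib)
  qed
  have "frame_of V y"
    unfolding frame_of_def using y frame a b
    by (intro conjI allI exI[of _ "a\<^sup>2"] exI[of _ "b\<^sup>2"]) auto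
  with ry show ?thesis unfolding riesz_basis_def by blast
qed

text \<open>
  In a weaving only the vectors with index in \<open>J\<close> are exchanged, so the perturbation vanishes off
  \<open>J\<close>.
\<close>

lemma synthesis_bound_restrict:
  fixes z :: "'i \<Rightarrow> real \<Rightarrow> complex"
  assumes "synthesis_bound z \<mu>"
  shows "synthesis_bound (\<lambda>i t. if i \<in> J then z i t else 0) \<mu>"
  unfolding synthesis_bound_def
proof (intro conjI allI impI)
  show "0 \<le> \<mu>" using assms by (simp add: synthesis_bound_def)
  fix K :: "'i set" and c :: "'i \<Rightarrow> complex" assume K: "finite K"
  have "(\<Sum>i\<in>K. c i * (if i \<in> J then z i t else 0)) = (\<Sum>i\<in>K \<inter> J. c i * z i t)" for t
    using K by (simp add: sum.inter_restrict if_distrib[of "\<lambda>w. _ * w"] cong: if_cong)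
  then have "(L2_norm (\<lambda>t. \<Sum>i\<in>K. c i * (if i \<in> J then z i t else 0)))\<^sup>2
      \<le> \<mu> * (\<Sum>i\<in>K \<inter> J. (cmod (c i))\<^sup>2)"
    using assms K by (simp add: synthesis_bound_def)
  also have "\<dots> \<le> \<mu> * (\<Sum>i\<in>K. (cmod (c i))\<^sup>2)"
    using \<open>0 \<le> \<mu>\<close> K by (intro mult_left_mono sum_mono2) auto
  finally show "(L2_norm (\<lambda>t. \<Sum>i\<in>K. c i * (if i \<in> J then z i t else 0)))\<^sup>2
      \<le> \<mu> * (\<Sum>i\<in>K. (cmod (c i))\<^sup>2)" .
qed

section \<open>Continuity of translations\<close>

lemma integral_translate:
  fixes f :: "real \<Rightarrow> 'a::{banach, second_countable_topology}"
  shows "(LINT x|lborel. f (t + x)) = (LINT x|lborel. f x)"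
  using lborel_integral_real_affine[of 1 f t] by simp

lemma integrable_translate:
  fixes f :: "real \<Rightarrow> 'a::{banach, second_countable_topology}"
  shows "integrable lborel f \<Longrightarrow> integrable lborel (\<lambda>x. f (t + x))"
  using lborel_integrable_real_affine[of f 1 t] by simp

text \<open>
  The functions on which translation is continuous in \<open>L\<^sup>1\<close> form a closed set, since translations are
  isometries.
\<close>

lemma L1_translation_approx:
  fixes f :: "real \<Rightarrow> 'a::{banach, second_countable_topology}"
  assumes f: "integrable lborel f"
    and approx: "\<And>\<epsilon>. 0 < \<epsilon> \<Longrightarrow> \<exists>g. integrable lborel g \<and> (LINT x|lborel. norm (f x - g x)) < \<epsilon> \<and>
      (\<lambda>n. LINT x|lborel. norm (g (t n + x) - g x)) \<longlonglongrightarrow> 0"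
  shows "(\<lambda>n. LINT x|lborel. norm (f (t n + x) - f x)) \<longlonglongrightarrow> 0"
proof (rule LIMSEQ_I)
  fix r :: real assume "0 < r"
  then obtain g where g: "integrable lborel g" "(LINT x|lborel. norm (f x - g x)) < r / 3"
      "(\<lambda>n. LINT x|lborel. norm (g (t n + x) - g x)) \<longlonglongrightarrow> 0"
    using approx[of "r / 3"] by auto
  obtain N where N: "\<And>n. n \<ge> N \<Longrightarrow> (LINT x|lborel. norm (g (t n + x) - g x)) < r / 3"
    using LIMSEQ_D[OF g(3), of "r/3"] \<open>0 < r\<close> by auto
  have "(LINT x|lborel. norm (f (t n + x) - f x)) < r" if "n \<ge> N" for n
  proof -
    have d: "integrable lborel (\<lambda>x. f x - g x)" using f g(1) by simp
    have i1: "integrable lborel (\<lambda>x. norm (f (t n + x) - g (t n + x)))"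
      using integrable_translate[OF integrable_norm[OF d]] by simp
    have i2: "integrable lborel (\<lambda>x. norm (g (t n + x) - g x))"
      by (intro integrable_norm Bochner_Integration.integrable_diff integrable_translate g(1))
    have i3: "integrable lborel (\<lambda>x. norm (f x - g x))"
      using d by (rule integrable_norm)
    have "(LINT x|lborel. norm (f (t n + x) - f x)) \<le>
      (LINT x|lborel. norm (f (t n + x) - g (t n + x)) + norm (g (t n + x) - g x) + norm (f x - g x))"
    proof (rule integral_mono)
      show "integrable lborel (\<lambda>x. norm (f (t n + x) - f x))"
        by (intro integrable_norm Bochner_Integration.integrable_diff integrable_translate f)
      show "integrable lborel (\<lambda>x. norm (f (t n + x) - g (t n + x)) + norm (g (t n + x) - g x) + norm (f x - g x))"
        by (intro Bochner_Integration.integrable_add i1 i2 i3)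
      show "norm (f (t n + x) - f x) \<le> norm (f (t n + x) - g (t n + x)) + norm (g (t n + x) - g x) + norm (f x - g x)" for x
      proof -
        have "norm (u + v - w) \<le> norm u + norm v + norm w" for u v w :: 'a
          using norm_triangle_ineq4[of "u + v" w] norm_triangle_ineq[of u v] by linarith
        from this[of "f (t n + x) - g (t n + x)" "g (t n + x) - g x" "f x - g x"]
        show ?thesis by simp
      qed
    qed
    also have "\<dots> = (LINT x|lborel. norm (f x - g x)) + (LINT x|lborel. norm (g (t n + x) - g x)) + (LINT x|lborel. norm (f x - g x))"
      using i1 i2 i3 integral_translate[of "\<lambda>x. norm (f x - g x)" "t n"] by simp
    also have "\<dots> < r" using N[OF that] g(2) by simp
    finally show ?thesis .
  qed
  then show "\<exists>N. \<forall>n\<ge>N. norm ((LINT x|lborel. norm (f (t n + x) - f x)) - 0) < r"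
    by (intro exI[of _ N]) simp
qed

text \<open>
  Openness of \<open>U\<close> makes \<open>x + t\<^sub>n\<close> stay in \<open>U\<close> eventually for every \<open>x\<close> in \<open>U\<close>, so the measure of the
  overlap of \<open>U\<close> with its translate tends to that of \<open>U\<close> by dominated convergence; the symmetric
  difference is expressed through the overlap.
\<close>

lemma L1_translation_indicator_open:
  fixes c :: "'a::{banach, second_countable_topology}"
  assumes U: "open U" "emeasure lborel U < \<infinity>" and t: "t \<longlonglongrightarrow> (0::real)"
  shows "(\<lambda>n. LINT x|lborel. norm (indicator U (t n + x) *\<^sub>R c - indicator U x *\<^sub>R c)) \<longlonglongrightarrow> 0"
proof -
  let ?i = "indicator U :: real \<Rightarrow> real"
  have m[measurable]: "U \<in> sets borel" using U(1) by simp
  have i: "integrable lborel ?i" using U by (simp add: integrable_indicator_iff)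
  have it: "integrable lborel (\<lambda>x. ?i (t n + x))" for n using i by (rule integrable_translate)
  have ip: "integrable lborel (\<lambda>x. ?i (t n + x) * ?i x)" for n
    by (rule Bochner_Integration.integrable_bound[OF i]) (auto split: split_indicator)
  have "(\<lambda>n. LINT x|lborel. ?i (t n + x) * ?i x) \<longlonglongrightarrow> (LINT x|lborel. ?i x)"
  proof (rule integral_dominated_convergence[where w = ?i])
    show "AE x in lborel. (\<lambda>n. ?i (t n + x) * ?i x) \<longlonglongrightarrow> ?i x"
    proof (rule AE_I2)
      fix x
      show "(\<lambda>n. ?i (t n + x) * ?i x) \<longlonglongrightarrow> ?i x"
      proof (cases "x \<in> U")
        case True
        have "(\<lambda>n. t n + x) \<longlonglongrightarrow> 0 + x" by (intro tendsto_add t tendsto_const)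
        then have "eventually (\<lambda>n. t n + x \<in> U) sequentially"
          using topological_tendstoD[OF _ U(1)] True by simp
        then have "eventually (\<lambda>n. ?i (t n + x) * ?i x = ?i x) sequentially"
          by eventually_elim (use True in auto)
        then show ?thesis by (rule tendsto_eventually)
      qed simp
    qed
  qed (auto intro!: i split: split_indicator)
  then have "(\<lambda>n. 2 * norm c * ((LINT x|lborel. ?i x) - (LINT x|lborel. ?i (t n + x) * ?i x)))
      \<longlonglongrightarrow> 2 * norm c * ((LINT x|lborel. ?i x) - (LINT x|lborel. ?i x))"
    by (intro tendsto_intros)
  moreover have "(LINT x|lborel. norm (?i (t n + x) *\<^sub>R c - ?i x *\<^sub>R c))
      = 2 * norm c * ((LINT x|lborel. ?i x) - (LINT x|lborel. ?i (t n + x) * ?i x))" for n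
  proof -
    have "(LINT x|lborel. norm (?i (t n + x) *\<^sub>R c - ?i x *\<^sub>R c))
        = (LINT x|lborel. norm c * (?i (t n + x) + ?i x - 2 * (?i (t n + x) * ?i x)))"
      by (intro Bochner_Integration.integral_cong) (auto split: split_indicator)
    also have "\<dots> = norm c * ((LINT x|lborel. ?i x) + (LINT x|lborel. ?i x) - 2 * (LINT x|lborel. ?i (t n + x) * ?i x))"
      using i it[of n] ip[of n] integral_translate[of ?i "t n"] by simp
    finally show ?thesis by (simp add: algebra_simps)
  qed
  ultimately show ?thesis by simp
qed

text \<open>
  By outer regularity an indicator function is an \<open>L\<^sup>1\<close> limit of indicator functions of open sets, and
  linear combinations and \<open>L\<^sup>1\<close> limits do the rest.
\<close>

lemma L1_translation_continuous:
  fixes f :: "real \<Rightarrow> 'a::{banach, second_countable_topology}"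
  assumes "integrable lborel f" and t: "t \<longlonglongrightarrow> 0"
  shows "(\<lambda>n. LINT x|lborel. norm (f (t n + x) - f x)) \<longlonglongrightarrow> 0"
  using assms(1)
proof (induction rule: integrable_induct)
  case (base A c)
  then have A[measurable]: "A \<in> sets borel" by simp
  show ?case
  proof (rule L1_translation_approx)
    show "integrable lborel (\<lambda>x. indicator A x *\<^sub>R c)"
      using base by (intro integrable_scaleR_left) (simp add: integrable_indicator_iff)
    fix \<epsilon> :: real assume "0 < \<epsilon>"
    \<comment> \<open>the summand \<open>1\<close> covers \<open>c = 0\<close>\<close>
    define \<delta> where "\<delta> = \<epsilon> / (norm c + 1)"
    have \<delta>: "0 < \<delta>" "\<delta> * norm c < \<epsilon>"
      using \<open>0 < \<epsilon>\<close> norm_ge_zero[of c]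
      by (simp_all add: \<delta>_def pos_divide_less_eq distrib_left del: norm_ge_zero)
    obtain U where U: "open U" "A \<subseteq> U" "emeasure lborel (U - A) < \<delta>"
      using outer_regular_lborel[OF A \<delta>(1)] by blast
    have [measurable]: "U \<in> sets borel" using U(1) by simp
    have "emeasure lborel U \<le> emeasure lborel A + emeasure lborel (U - A)"
      using U(2) by (subst plus_emeasure) (auto intro!: emeasure_mono)
    also have "\<dots> < \<infinity>" using base U(3) by (auto simp: less_top[symmetric] top_unique)
    finally have Ufin: "emeasure lborel U < \<infinity>" .
    have "(LINT x|lborel. norm (indicator A x *\<^sub>R c - indicator U x *\<^sub>R c))
        = (LINT x|lborel. indicator (U - A) x * norm c)"
      using U(2) by (intro Bochner_Integration.integral_cong) (auto split: split_indicator)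
    also have "\<dots> = measure lborel (U - A) * norm c" by simp
    also have "\<dots> \<le> \<delta> * norm c"
      using U(3) \<delta>(1) by (intro mult_right_mono) (auto simp: measure_def enn2real_leI less_imp_le)
    finally have "(LINT x|lborel. norm (indicator A x *\<^sub>R c - indicator U x *\<^sub>R c)) < \<epsilon>" using \<delta>(2) by simp
    then show "\<exists>g. integrable lborel g \<and> (LINT x|lborel. norm (indicator A x *\<^sub>R c - g x)) < \<epsilon> \<and>
      (\<lambda>n. LINT x|lborel. norm (g (t n + x) - g x)) \<longlonglongrightarrow> 0"
      using L1_translation_indicator_open[OF U(1) Ufin t, of c] Ufin
      by (intro exI[of _ "\<lambda>x. indicator U x *\<^sub>R c"] conjI integrable_scaleR_left)
         (simp_all add: integrable_indicator_iff)
  qed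
next
  case (add f g)
  have "(LINT x|lborel. norm (f (t n + x) + g (t n + x) - (f x + g x)))
      \<le> (LINT x|lborel. norm (f (t n + x) - f x)) + (LINT x|lborel. norm (g (t n + x) - g x))" for n
  proof -
    have i: "integrable lborel (\<lambda>x. norm (f (t n + x) - f x))" "integrable lborel (\<lambda>x. norm (g (t n + x) - g x))"
      by (intro integrable_norm Bochner_Integration.integrable_diff integrable_translate add.hyps)+
    have "(LINT x|lborel. norm (f (t n + x) + g (t n + x) - (f x + g x)))
      \<le> (LINT x|lborel. norm (f (t n + x) - f x) + norm (g (t n + x) - g x))"
      by (intro integral_mono integrable_norm Bochner_Integration.integrable_diff
          Bochner_Integration.integrable_add integrable_translate add.hyps norm_diff_triangle_ineq)
    with i show ?thesis by simp
  qed
  moreover have "(\<lambda>n. (LINT x|lborel. norm (f (t n + x) - f x)) + (LINT x|lborel. norm (g (t n + x) - g x))) \<longlonglongrightarrow> 0"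
    using tendsto_add[OF add.IH] by simp
  ultimately show ?case
    by (elim tendsto_sandwich[OF always_eventually always_eventually tendsto_const, rotated 2]) simp_all
next
  case (lim f s)
  show ?case
  proof (rule L1_translation_approx)
    show "integrable lborel f" by fact
    have fm: "f \<in> borel_measurable lborel" "\<And>i. s i \<in> borel_measurable lborel"
      using lim.hyps by auto
    have "(\<lambda>i. LINT x|lborel. norm (f x - s i x)) \<longlonglongrightarrow> (LINT x|(lborel::real measure). 0)"
    proof (rule integral_dominated_convergence[where w = "\<lambda>x. 3 * norm (f x)"])
      show "AE x in lborel. (\<lambda>i. norm (f x - s i x)) \<longlonglongrightarrow> 0"
        using lim.hyps(2) by (intro AE_I2 tendsto_norm_zero) (auto intro!: tendsto_eq_intros)
      show "AE x in lborel. norm (norm (f x - s i x)) \<le> 3 * norm (f x)" for i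
      proof (rule AE_I2)
        fix x assume "x \<in> space (lborel :: real measure)"
        then have "norm (s i x) \<le> 2 * norm (f x)" using lim.hyps(3) by auto
        then show "norm (norm (f x - s i x)) \<le> 3 * norm (f x)"
          using norm_triangle_ineq4[of "f x" "s i x"] by simp
      qed
      show "integrable lborel (\<lambda>x. 3 * norm (f x))" using lim.hyps by simp
    qed (use fm in measurable)
    then have l: "(\<lambda>i. LINT x|lborel. norm (f x - s i x)) \<longlonglongrightarrow> 0" by simp
    fix \<epsilon> :: real assume "0 < \<epsilon>"
    then obtain i where "(LINT x|lborel. norm (f x - s i x)) < \<epsilon>"
      using order_tendstoD(2)[OF l, of \<epsilon>] by (auto simp: eventually_sequentially)
    then show "\<exists>g. integrable lborel g \<and> (LINT x|lborel. norm (f x - g x)) < \<epsilon> \<and>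
      (\<lambda>n. LINT x|lborel. norm (g (t n + x) - g x)) \<longlonglongrightarrow> 0"
      using lim.IH lim.hyps by blast
  qed
qed

text \<open>
  Cut off the values of \<open>f\<close> at height \<open>M\<close>: for functions bounded by \<open>M\<close> the squared \<open>L\<^sup>2\<close> distance
  is at most \<open>2M\<close> times the \<open>L\<^sup>1\<close> distance.
\<close>

lemma L2_translation_continuous:
  assumes f: "f \<in> L2" "integrable lborel f" and t: "t \<longlonglongrightarrow> 0"
  shows "(\<lambda>n. L2_norm (\<lambda>x. f (t n + x) - f x)) \<longlonglongrightarrow> 0"
proof (rule LIMSEQ_I)
  fix r :: real assume r: "0 < r"
  define g where "g M x = (if cmod (f x) \<le> real M then f x else 0)" for M x
  have fm[measurable]: "f \<in> borel_measurable borel" using f(1) by (rule L2_measurable)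
  have gm[measurable]: "g M \<in> borel_measurable borel" for M unfolding g_def by measurable
  have gL1: "integrable lborel (g M)" for M
    by (rule Bochner_Integration.integrable_bound[OF f(2)]) (auto simp: g_def)
  have gL2: "g M \<in> L2" for M
    by (rule L2_I_bound[OF _ L2_integrable[OF f(1)]]) (auto simp: g_def)
  have "(\<lambda>M. LINT x|lborel. (cmod (f x - g M x))\<^sup>2) \<longlonglongrightarrow> (LINT x|(lborel::real measure). 0)"
  proof (rule integral_dominated_convergence[where w = "\<lambda>x. (cmod (f x))\<^sup>2"])
    show "AE x in lborel. (\<lambda>M. (cmod (f x - g M x))\<^sup>2) \<longlonglongrightarrow> 0"
    proof (rule AE_I2)
      fix x
      obtain N :: nat where "cmod (f x) \<le> real N" using real_arch_simple by blast
      then have "\<forall>M\<ge>N. (cmod (f x - g M x))\<^sup>2 = 0" by (auto simp: g_def)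
      then show "(\<lambda>M. (cmod (f x - g M x))\<^sup>2) \<longlonglongrightarrow> 0"
        by (intro tendsto_eventually) (auto simp: eventually_sequentially)
    qed
  qed (auto simp: L2_integrable[OF f(1)] g_def)
  then have "(\<lambda>M. sqrt (LINT x|lborel. (cmod (f x - g M x))\<^sup>2)) \<longlonglongrightarrow> sqrt 0"
    by (intro tendsto_real_sqrt) simp
  then have l: "(\<lambda>M. L2_norm (\<lambda>x. f x - g M x)) \<longlonglongrightarrow> 0" by (simp add: L2_norm_def)
  obtain M where M: "L2_norm (\<lambda>x. f x - g M x) < r / 3"
    using order_tendstoD(2)[OF l, of "r/3"] r by (auto simp: eventually_sequentially)
  have lim: "(\<lambda>n. sqrt (2 * real M * (LINT x|lborel. norm (g M (t n + x) - g M x)))) \<longlonglongrightarrow> sqrt (2 * real M * 0)"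
    by (intro tendsto_intros L1_translation_continuous gL1 t)
  obtain N where N: "\<And>n. n \<ge> N \<Longrightarrow> sqrt (2 * real M * (LINT x|lborel. norm (g M (t n + x) - g M x))) < r / 3"
    using order_tendstoD(2)[OF lim, of "r/3"] r by (auto simp: eventually_sequentially)
  have "L2_norm (\<lambda>x. f (t n + x) - f x) < r" if n: "n \<ge> N" for n
  proof -
    have tr: "(\<lambda>x. f (t n + x)) \<in> L2" "(\<lambda>x. g M (t n + x)) \<in> L2"
      by (intro L2_translate f gL2)+
    have "(LINT x|lborel. (cmod (g M (t n + x) - g M x))\<^sup>2)
        \<le> (LINT x|lborel. 2 * real M * cmod (g M (t n + x) - g M x))"
    proof (rule integral_mono)
      show "integrable lborel (\<lambda>x. (cmod (g M (t n + x) - g M x))\<^sup>2)"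
        by (intro L2_integrable L2_diff tr gL2)
      show "integrable lborel (\<lambda>x. 2 * real M * cmod (g M (t n + x) - g M x))"
        by (intro integrable_mult_right integrable_norm Bochner_Integration.integrable_diff integrable_translate gL1)
      have b: "cmod (g M x) \<le> real M" for x by (simp add: g_def)
      have "cmod (g M (t n + x) - g M x) \<le> 2 * real M" for x
        using norm_triangle_ineq4[of "g M (t n + x)" "g M x"] b[of x] b[of "t n + x"] by linarith
      then show "(cmod (g M (t n + x) - g M x))\<^sup>2 \<le> 2 * real M * cmod (g M (t n + x) - g M x)" for x
        unfolding power2_eq_square by (intro mult_right_mono) auto
    qed
    then have "L2_norm (\<lambda>x. g M (t n + x) - g M x) \<le> sqrt (2 * real M * (LINT x|lborel. norm (g M (t n + x) - g M x)))"
      by (simp add: L2_norm_def)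
    then have "L2_norm (\<lambda>x. g M (t n + x) - g M x) < r / 3" using N[OF n] by simp
    moreover have "L2_norm (\<lambda>x. f (t n + x) - g M (t n + x)) < r / 3"
      using M L2_norm_translate[of "\<lambda>x. f x - g M x" "t n"] by simp
    moreover have "L2_norm (\<lambda>x. g M x - f x) < r / 3"
      using M by (simp add: L2_norm_minus_commute[of "g M"])
    ultimately show ?thesis
      using L2_norm_triangle_via[OF tr f(1)] L2_norm_triangle_via[OF tr(2) gL2[of M] f(1)]
      by linarith
  qed
  then show "\<exists>N. \<forall>n\<ge>N. norm (L2_norm (\<lambda>x. f (t n + x) - f x) - 0) < r"
    by (intro exI[of _ N]) (simp add: L2_norm_nonneg)
qed

section \<open>Plancherel's theorem\<close>

lemma cis_measurable [measurable]: "cis \<in> borel_measurable borel"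
  by (intro borel_measurable_continuous_onI continuous_intros)

lemma cnj_measurable [measurable]: "cnj \<in> borel_measurable borel"
  by (intro borel_measurable_continuous_onI continuous_intros)

lemma fourier_integral_cis: "fourier_integral f \<xi> = (LINT x|lborel. f x * cis (- (2 * pi * x * \<xi>)))"
  unfolding fourier_integral_def cis_conv_exp
  by (intro Bochner_Integration.integral_cong refl arg_cong2[where f="(*)"] arg_cong[where f=exp])
     (simp add: mult_ac)

lemma fourier_integral_integrable:
  "integrable lborel f \<Longrightarrow> integrable lborel (\<lambda>x. f x * cis (a * x))"
  by (rule Bochner_Integration.integrable_bound[of _ f]) (auto simp: norm_mult)

lemma fourier_integral_measurable:
  assumes [measurable]: "f \<in> borel_measurable borel"
  shows "fourier_integral f \<in> borel_measurable borel"
  unfolding fourier_integral_cis by measurable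

lemma fourier_integral_bound: "cmod (fourier_integral f \<xi>) \<le> (LINT x|lborel. cmod (f x))"
  unfolding fourier_integral_cis
  by (rule order_trans[OF integral_norm_bound]) (simp add: norm_mult)

lemma integrable_product_bound:
  fixes k :: "real \<times> real \<Rightarrow> complex" and f g :: "real \<Rightarrow> real"
  assumes f: "integrable lborel f" and g: "integrable lborel g"
    and [measurable]: "k \<in> borel_measurable (lborel \<Otimes>\<^sub>M lborel)"
    and le: "\<And>x y. cmod (k (x, y)) \<le> \<bar>f x\<bar> * \<bar>g y\<bar>"
  shows "integrable (lborel \<Otimes>\<^sub>M lborel) k"
proof (rule Bochner_Integration.integrable_bound)
  have [measurable]: "f \<in> borel_measurable lborel" "g \<in> borel_measurable lborel"
    using f g by auto
  show "integrable (lborel \<Otimes>\<^sub>M lborel) (\<lambda>(x, y). f x * g y)"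
  proof (rule lborel_pair.Fubini_integrable)
    show "integrable lborel (\<lambda>x. LINT y|lborel. norm (case (x, y) of (x, y) \<Rightarrow> f x * g y))"
      using integrable_norm[OF f] by (simp add: abs_mult)
    show "AE x in lborel. integrable lborel (\<lambda>y. case (x, y) of (x, y) \<Rightarrow> f x * g y)"
      using g by simp
  qed measurable
  show "AE z in lborel \<Otimes>\<^sub>M lborel. norm (k z) \<le> norm (case z of (x, y) \<Rightarrow> f x * g y)"
    using le by (auto simp: abs_mult)
qed measurable

lemma integrable_std_normal_density: "integrable lborel std_normal_density"
  using integrable_std_normal_moment[of 0] by simp

lemma gaussian_fourier:
  "(LINT v|lborel. complex_of_real (std_normal_density v) * cis (t * v)) = complex_of_real (exp (- t\<^sup>2 / 2))"
proof -
  have "char std_normal_distribution t = (LINT v|lborel. std_normal_density v *\<^sub>R cis (t * v))"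
    unfolding char_def cis_conv_exp by (subst integral_density) auto
  then show ?thesis
    by (simp add: char_std_normal_distribution scaleR_conv_of_real)
qed

text \<open>
  With frequency scale \<open>2\<pi>\<sigma>\<close> the inverse Fourier transform of the Gaussian weight is, up to the factor
  \<open>1/\<surd>(2\<pi>)\<close>, the normal density of standard deviation \<open>\<sigma>\<close>.
\<close>

lemma gaussian_fourier_scaled:
  assumes "0 < \<sigma>"
  shows "(LINT \<xi>|lborel. complex_of_real (std_normal_density (2 * pi * \<sigma> * \<xi>)) * cis (2 * pi * u * \<xi>))
    = complex_of_real (std_normal_density (u / \<sigma>) / (sqrt (2 * pi) * \<sigma>))"
proof -
  let ?c = "2 * pi * \<sigma>"
  have c: "?c > 0" using assms by simp
  have "(LINT v|lborel. complex_of_real (std_normal_density v) * cis (u / \<sigma> * v))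
      = \<bar>?c\<bar> *\<^sub>R (LINT \<xi>|lborel. complex_of_real (std_normal_density (?c * \<xi>)) * cis (u / \<sigma> * (?c * \<xi>)))"
    using lborel_integral_real_affine[of ?c "\<lambda>v. complex_of_real (std_normal_density v) * cis (u / \<sigma> * v)" 0] c
    by (simp only: add_0_left)
  moreover have "u / \<sigma> * (?c * \<xi>) = 2 * pi * u * \<xi>" for \<xi> using assms by simp
  moreover have "\<bar>?c\<bar> = ?c" using c by simp
  ultimately have "complex_of_real ?c * (LINT \<xi>|lborel. complex_of_real (std_normal_density (?c * \<xi>)) * cis (2 * pi * u * \<xi>))
      = complex_of_real (exp (- (u / \<sigma>)\<^sup>2 / 2))"
    by (simp only: gaussian_fourier scaleR_conv_of_real)
  moreover have "z = complex_of_real (e / c)" if "complex_of_real c * z = complex_of_real e" "c > 0" for z e c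
    using that by (simp add: field_simps)
  ultimately have "(LINT \<xi>|lborel. complex_of_real (std_normal_density (?c * \<xi>)) * cis (2 * pi * u * \<xi>))
      = complex_of_real (exp (- (u / \<sigma>)\<^sup>2 / 2) / ?c)"
    using c by blast
  also have "exp (- (u / \<sigma>)\<^sup>2 / 2) / ?c = std_normal_density (u / \<sigma>) / (sqrt (2 * pi) * \<sigma>)"
    using assms by (simp add: std_normal_density_def real_sqrt_mult field_simps)
  finally show ?thesis .
qed

text \<open>
  Fourier inversion with a Gaussian convergence factor: the outcome is the mean of \<open>h\<close> around \<open>y\<close> for
  the normal distribution of standard deviation \<open>\<sigma>\<close>. It is Fubini's theorem followed by the
  substitution \<open>x = y - \<sigma>v\<close>.
\<close>

lemma gaussian_inversion:
  assumes h: "integrable lborel h" and \<sigma>: "0 < \<sigma>"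
  shows "(LINT \<xi>|lborel. complex_of_real (std_normal_density (2 * pi * \<sigma> * \<xi>)) * fourier_integral h \<xi> * cis (2 * pi * y * \<xi>))
    = complex_of_real (1 / sqrt (2 * pi)) * (LINT v|lborel. complex_of_real (std_normal_density v) * h (y - \<sigma> * v))"
proof -
  have [measurable]: "h \<in> borel_measurable borel" using h by simp
  let ?w = "\<lambda>\<xi>. complex_of_real (std_normal_density (2 * pi * \<sigma> * \<xi>))"
  have iw: "integrable lborel (\<lambda>\<xi>. std_normal_density (2 * pi * \<sigma> * \<xi>))"
    using lborel_integrable_real_affine[OF integrable_std_normal_density, of "2 * pi * \<sigma>" 0] \<sigma> by simp
  have "(LINT \<xi>|lborel. ?w \<xi> * fourier_integral h \<xi> * cis (2 * pi * y * \<xi>))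
      = (LINT \<xi>|lborel. LINT x|lborel. h x * (?w \<xi> * cis (2 * pi * (y - x) * \<xi>)))"
  proof (rule Bochner_Integration.integral_cong[OF refl])
    fix \<xi>
    have "?w \<xi> * fourier_integral h \<xi> * cis (2 * pi * y * \<xi>)
        = (LINT x|lborel. (?w \<xi> * cis (2 * pi * y * \<xi>)) * (h x * cis (- (2 * pi * x * \<xi>))))"
      unfolding integral_mult_right_zero fourier_integral_cis by (simp only: mult_ac)
    also have "\<dots> = (LINT x|lborel. h x * (?w \<xi> * cis (2 * pi * (y - x) * \<xi>)))"
    proof (rule Bochner_Integration.integral_cong[OF refl])
      fix x
      have "cis (2 * pi * (y - x) * \<xi>) = cis (2 * pi * y * \<xi>) * cis (- (2 * pi * x * \<xi>))"
        unfolding cis_mult by (simp add: algebra_simps)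
      then show "(?w \<xi> * cis (2 * pi * y * \<xi>)) * (h x * cis (- (2 * pi * x * \<xi>)))
          = h x * (?w \<xi> * cis (2 * pi * (y - x) * \<xi>))" by (simp add: mult_ac)
    qed
    finally show "?w \<xi> * fourier_integral h \<xi> * cis (2 * pi * y * \<xi>)
        = (LINT x|lborel. h x * (?w \<xi> * cis (2 * pi * (y - x) * \<xi>)))" .
  qed
  also have "\<dots> = (LINT x|lborel. LINT \<xi>|lborel. h x * (?w \<xi> * cis (2 * pi * (y - x) * \<xi>)))"
  proof (rule lborel_pair.Fubini_integral)
    show "integrable (lborel \<Otimes>\<^sub>M lborel) (\<lambda>(x, \<xi>). h x * (?w \<xi> * cis (2 * pi * (y - x) * \<xi>)))"
      by (rule integrable_product_bound[OF integrable_norm[OF h] iw]) (measurable, simp add: norm_mult)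
  qed
  also have "\<dots> = (LINT x|lborel. h x * complex_of_real (std_normal_density ((y - x) / \<sigma>) / (sqrt (2 * pi) * \<sigma>)))"
    by (simp only: integral_mult_right_zero gaussian_fourier_scaled[OF \<sigma>])
  also have "\<dots> = \<sigma> *\<^sub>R (LINT v|lborel. h (y + - \<sigma> * v) * complex_of_real (std_normal_density ((y - (y + - \<sigma> * v)) / \<sigma>) / (sqrt (2 * pi) * \<sigma>)))"
    using lborel_integral_real_affine[of "-\<sigma>" "\<lambda>x. h x * complex_of_real (std_normal_density ((y - x) / \<sigma>) / (sqrt (2 * pi) * \<sigma>))" y] \<sigma>
    by simp
  also have "\<dots> = (LINT v|lborel. complex_of_real (1 / sqrt (2 * pi)) * (complex_of_real (std_normal_density v) * h (y - \<sigma> * v)))"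
    unfolding integral_scaleR_right[symmetric]
    using \<sigma> by (intro Bochner_Integration.integral_cong refl) (simp add: scaleR_conv_of_real)
  also have "\<dots> = complex_of_real (1 / sqrt (2 * pi)) * (LINT v|lborel. complex_of_real (std_normal_density v) * h (y - \<sigma> * v))"
    by (rule integral_mult_right_zero)
  finally show ?thesis .
qed

text \<open>
  The autocorrelation \<open>t \<mapsto> \<langle>h(t + \<cdot>), h\<rangle>\<close> takes the place of \<open>h\<close> here: writing one factor of
  \<open>|h^|\<^sup>2\<close> as an integral over \<open>y\<close> reduces the claim to the previous lemma at each \<open>y\<close>. The factor
  \<open>\<surd>(2\<pi>)\<close> normalises the weight to \<open>1\<close> at \<open>\<xi> = 0\<close>.
\<close>

lemma gaussian_mean_of_fourier_square:
  assumes h: "integrable lborel h" "h \<in> L2" and \<sigma>: "0 < \<sigma>"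
  shows "complex_of_real (LINT \<xi>|lborel. sqrt (2 * pi) * std_normal_density (2 * pi * \<sigma> * \<xi>) * (cmod (fourier_integral h \<xi>))\<^sup>2)
    = (LINT v|lborel. complex_of_real (std_normal_density v) * L2_inner (\<lambda>y. h (- (\<sigma> * v) + y)) h)"
proof -
  have [measurable]: "h \<in> borel_measurable borel" using h by simp
  note [measurable] = fourier_integral_measurable[OF this]
  let ?w = "\<lambda>\<xi>. std_normal_density (2 * pi * \<sigma> * \<xi>)"
  let ?F = "fourier_integral h"
  let ?C = "LINT x|lborel. cmod (h x)"
  have iw: "integrable lborel ?w"
    using lborel_integrable_real_affine[OF integrable_std_normal_density, of "2 * pi * \<sigma>" 0] \<sigma> by simp
  have "complex_of_real (LINT \<xi>|lborel. ?w \<xi> * (cmod (?F \<xi>))\<^sup>2)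
      = (LINT \<xi>|lborel. LINT y|lborel. cnj (h y) * (complex_of_real (?w \<xi>) * ?F \<xi> * cis (2 * pi * y * \<xi>)))"
    unfolding integral_complex_of_real[symmetric]
  proof (rule Bochner_Integration.integral_cong[OF refl])
    fix \<xi>
    have "complex_of_real (?w \<xi> * (cmod (?F \<xi>))\<^sup>2) = complex_of_real (?w \<xi>) * ?F \<xi> * cnj (?F \<xi>)"
      by (simp add: complex_norm_square del: of_real_power)
    also have "cnj (?F \<xi>) = (LINT y|lborel. cnj (h y) * cis (2 * pi * y * \<xi>))"
      unfolding fourier_integral_cis Bochner_Integration.integral_cnj[symmetric]
      by (simp add: cis_cnj)
    finally show "complex_of_real (?w \<xi> * (cmod (?F \<xi>))\<^sup>2) = (LINT y|lborel. cnj (h y) * (complex_of_real (?w \<xi>) * ?F \<xi> * cis (2 * pi * y * \<xi>)))"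
      unfolding integral_mult_right_zero[symmetric] by (simp only: mult_ac)
  qed
  also have "\<dots> = (LINT y|lborel. LINT \<xi>|lborel. cnj (h y) * (complex_of_real (?w \<xi>) * ?F \<xi> * cis (2 * pi * y * \<xi>)))"
  proof (rule lborel_pair.Fubini_integral)
    show "integrable (lborel \<Otimes>\<^sub>M lborel) (\<lambda>(y, \<xi>). cnj (h y) * (complex_of_real (?w \<xi>) * ?F \<xi> * cis (2 * pi * y * \<xi>)))"
    proof (rule integrable_product_bound[OF integrable_norm[OF h(1)] integrable_mult_right[OF iw, of ?C]])
      fix y \<xi>
      have "\<bar>?C\<bar> = ?C" by simp
      then show "cmod (case (y, \<xi>) of (y, \<xi>) \<Rightarrow> cnj (h y) * (complex_of_real (?w \<xi>) * ?F \<xi> * cis (2 * pi * y * \<xi>)))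
          \<le> \<bar>cmod (h y)\<bar> * \<bar>?C * ?w \<xi>\<bar>"
        using fourier_integral_bound[of h \<xi>]
        by (simp add: norm_mult abs_mult mult_left_mono mult_right_mono mult.commute[of ?C])
    qed measurable
  qed
  also have "\<dots> = (LINT y|lborel. cnj (h y) * (complex_of_real (1 / sqrt (2 * pi)) * (LINT v|lborel. complex_of_real (std_normal_density v) * h (y - \<sigma> * v))))"
    by (simp only: integral_mult_right_zero gaussian_inversion[OF h(1) \<sigma>])
  also have "\<dots> = complex_of_real (1 / sqrt (2 * pi)) *
      (LINT y|lborel. LINT v|lborel. complex_of_real (std_normal_density v) * (h (- (\<sigma> * v) + y) * cnj (h y)))"
    unfolding integral_mult_right_zero[symmetric]
    by (intro Bochner_Integration.integral_cong refl) (simp add: mult_ac)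
  also have "(LINT y|lborel. LINT v|lborel. complex_of_real (std_normal_density v) * (h (- (\<sigma> * v) + y) * cnj (h y)))
     = (LINT v|lborel. LINT y|lborel. complex_of_real (std_normal_density v) * (h (- (\<sigma> * v) + y) * cnj (h y)))"
  proof (rule lborel_pair.Fubini_integral)
    have tr: "(\<lambda>y. h (- (\<sigma> * v) + y)) \<in> L2" for v by (rule L2_translate[OF h(2)])
    show "integrable (lborel \<Otimes>\<^sub>M lborel) (\<lambda>(v, y). complex_of_real (std_normal_density v) * (h (- (\<sigma> * v) + y) * cnj (h y)))"
    proof (rule lborel_pair.Fubini_integrable)
      show "AE v in lborel. integrable lborel (\<lambda>y. case (v, y) of (v, y) \<Rightarrow> complex_of_real (std_normal_density v) * (h (- (\<sigma> * v) + y) * cnj (h y)))"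
        using L2_integrable_inner[OF tr h(2)] by auto
      show "integrable lborel (\<lambda>v. LINT y|lborel. norm (case (v, y) of (v, y) \<Rightarrow> complex_of_real (std_normal_density v) * (h (- (\<sigma> * v) + y) * cnj (h y))))"
      proof (rule Bochner_Integration.integrable_bound[OF integrable_mult_right[OF integrable_std_normal_density, of "(L2_norm h)\<^sup>2"]])
        show "AE v in lborel. norm (LINT y|lborel. norm (case (v, y) of (v, y) \<Rightarrow> complex_of_real (std_normal_density v) * (h (- (\<sigma> * v) + y) * cnj (h y))))
          \<le> norm ((L2_norm h)\<^sup>2 * std_normal_density v)"
        proof (rule AE_I2)
          fix v
          have "(LINT y|lborel. cmod (h (- (\<sigma> * v) + y)) * cmod (h y)) \<le> L2_norm h * L2_norm h"
            using L2_Cauchy_Schwarz_abs[OF tr h(2), of v] L2_norm_translate[of h "- (\<sigma> * v)"] by simp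
          moreover have "0 \<le> (LINT y|lborel. cmod (h (- (\<sigma> * v) + y)) * cmod (h y))" by simp
          ultimately show "norm (LINT y|lborel. norm (case (v, y) of (v, y) \<Rightarrow> complex_of_real (std_normal_density v) * (h (- (\<sigma> * v) + y) * cnj (h y))))
          \<le> norm ((L2_norm h)\<^sup>2 * std_normal_density v)"
            by (simp add: norm_mult abs_mult power2_eq_square mult_left_mono mult.commute[of _ "std_normal_density v"])
        qed
      qed measurable
    qed measurable
  qed
  also have "\<dots> = (LINT v|lborel. complex_of_real (std_normal_density v) * L2_inner (\<lambda>y. h (- (\<sigma> * v) + y)) h)"
    by (simp add: L2_inner_def)
  finally have *: "complex_of_real (LINT \<xi>|lborel. ?w \<xi> * (cmod (?F \<xi>))\<^sup>2)
     = complex_of_real (1 / sqrt (2 * pi)) * (LINT v|lborel. complex_of_real (std_normal_density v) * L2_inner (\<lambda>y. h (- (\<sigma> * v) + y)) h)" .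
  have "(LINT \<xi>|lborel. sqrt (2 * pi) * ?w \<xi> * (cmod (?F \<xi>))\<^sup>2) = sqrt (2 * pi) * (LINT \<xi>|lborel. ?w \<xi> * (cmod (?F \<xi>))\<^sup>2)"
    by (simp only: mult.assoc integral_mult_right_zero)
  then show ?thesis
    by (simp only: of_real_mult *) (simp add: mult.assoc[symmetric] of_real_mult[symmetric] del: of_real_mult)
qed

text \<open>
  Let \<open>\<sigma>\<close> decrease to \<open>0\<close> in the previous lemma. On the left the weights increase to \<open>1\<close>, so
  monotone convergence produces \<open>\<integral>|h^|\<^sup>2\<close>, finite or not. On the right the autocorrelation is bounded
  by \<open>\<parallel>h\<parallel>\<^sup>2\<close> and continuous at \<open>0\<close>, because translation is continuous in \<open>L\<^sup>2\<close>, and dominated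
  convergence produces its value \<open>\<parallel>h\<parallel>\<^sup>2\<close> there.
\<close>

theorem Plancherel_L1_L2:
  assumes h: "integrable lborel h" "h \<in> L2"
  shows "fourier_integral h \<in> L2" and "L2_norm (fourier_integral h) = L2_norm h"
proof -
  have [measurable]: "h \<in> borel_measurable borel" using h by simp
  note Fm[measurable] = fourier_integral_measurable[OF this]
  let ?F = "fourier_integral h"
  define \<sigma> where "\<sigma> n = 1 / real (Suc n)" for n
  have \<sigma>: "0 < \<sigma> n" for n by (simp add: \<sigma>_def)
  have \<sigma>0: "\<sigma> \<longlonglongrightarrow> 0" unfolding \<sigma>_def using LIMSEQ_inverse_real_of_nat by (simp only: inverse_eq_divide)
  define g where "g n \<xi> = sqrt (2 * pi) * std_normal_density (2 * pi * \<sigma> n * \<xi>)" for n \<xi>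
  have g_exp: "g n \<xi> = exp (- ((2 * pi * \<xi>)\<^sup>2 * (\<sigma> n)\<^sup>2) / 2)" for n \<xi>
    by (simp add: g_def std_normal_density_def power_mult_distrib mult_ac)
  have gm[measurable]: "g n \<in> borel_measurable borel" for n unfolding g_def by measurable
  have \<sigma>_dec: "\<sigma> n \<le> \<sigma> m" if "m \<le> n" for m n using that by (simp add: \<sigma>_def frac_le)
  have inc: "incseq (\<lambda>n. ennreal (g n \<xi> * (cmod (?F \<xi>))\<^sup>2))" for \<xi>
  proof (rule incseq_SucI)
    fix n
    have "(\<sigma> (Suc n))\<^sup>2 \<le> (\<sigma> n)\<^sup>2" using \<sigma>_dec[of n "Suc n"] \<sigma>[of "Suc n"] by (intro power_mono) auto
    then have "g n \<xi> \<le> g (Suc n) \<xi>" by (simp add: g_exp mult_left_mono)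
    then show "ennreal (g n \<xi> * (cmod (?F \<xi>))\<^sup>2) \<le> ennreal (g (Suc n) \<xi> * (cmod (?F \<xi>))\<^sup>2)"
      by (intro ennreal_leI mult_right_mono) auto
  qed
  have glim: "(\<lambda>n. ennreal (g n \<xi> * (cmod (?F \<xi>))\<^sup>2)) \<longlonglongrightarrow> ennreal ((cmod (?F \<xi>))\<^sup>2)" for \<xi>
  proof -
    have "(\<lambda>n. exp (- ((2 * pi * \<xi>)\<^sup>2 * (\<sigma> n)\<^sup>2) / 2)) \<longlonglongrightarrow> exp (- ((2 * pi * \<xi>)\<^sup>2 * 0\<^sup>2) / 2)"
      by (intro tendsto_intros \<sigma>0) auto
    then have "(\<lambda>n. g n \<xi> * (cmod (?F \<xi>))\<^sup>2) \<longlonglongrightarrow> 1 * (cmod (?F \<xi>))\<^sup>2"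
      by (intro tendsto_mult tendsto_const) (simp add: g_exp)
    then show ?thesis by (intro tendsto_ennrealI) simp
  qed
  have mono: "(\<lambda>n. \<integral>\<^sup>+\<xi>. ennreal (g n \<xi> * (cmod (?F \<xi>))\<^sup>2) \<partial>lborel) \<longlonglongrightarrow> (\<integral>\<^sup>+\<xi>. ennreal ((cmod (?F \<xi>))\<^sup>2) \<partial>lborel)"
    using inc by (intro nn_integral_LIMSEQ glim) (auto simp: incseq_def le_fun_def)
  have ig: "integrable lborel (\<lambda>\<xi>. g n \<xi> * (cmod (?F \<xi>))\<^sup>2)" for n
  proof -
    let ?C = "(LINT x|lborel. cmod (h x))\<^sup>2"
    have "integrable lborel (g n)"
      unfolding g_def using \<sigma>[of n]
      by (intro integrable_mult_right lborel_integrable_real_affine[OF integrable_std_normal_density, of "2 * pi * \<sigma> n" 0, simplified]) simp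
    then have "integrable lborel (\<lambda>\<xi>. ?C * g n \<xi>)" by simp
    then show ?thesis
    proof (rule Bochner_Integration.integrable_bound)
      show "AE \<xi> in lborel. norm (g n \<xi> * (cmod (?F \<xi>))\<^sup>2) \<le> norm (?C * g n \<xi>)"
        using fourier_integral_bound[of h]
        by (auto simp: abs_mult g_exp mult.commute intro!: power_mono)
    qed measurable
  qed
  let ?G = "\<lambda>n. LINT \<xi>|lborel. g n \<xi> * (cmod (?F \<xi>))\<^sup>2"
  have nn: "(\<integral>\<^sup>+\<xi>. ennreal (g n \<xi> * (cmod (?F \<xi>))\<^sup>2) \<partial>lborel) = ennreal (?G n)" for n
    by (intro nn_integral_eq_integral ig) (auto simp: g_exp)
  have R: "cmod (L2_inner (\<lambda>y. h (t + y)) h) \<le> (L2_norm h)\<^sup>2" for t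
    using L2_Cauchy_Schwarz[OF L2_translate[OF h(2)] h(2), of t] L2_norm_translate[of h t]
    by (simp add: power2_eq_square)
  have "(\<lambda>n. LINT v|lborel. complex_of_real (std_normal_density v) * L2_inner (\<lambda>y. h (- (\<sigma> n * v) + y)) h)
      \<longlonglongrightarrow> (LINT v|lborel. complex_of_real (std_normal_density v) * complex_of_real ((L2_norm h)\<^sup>2))"
  proof (rule integral_dominated_convergence[where w = "\<lambda>v. (L2_norm h)\<^sup>2 * std_normal_density v"])
    show "integrable lborel (\<lambda>v. (L2_norm h)\<^sup>2 * std_normal_density v)"
      using integrable_std_normal_density by simp
    show "(\<lambda>v. complex_of_real (std_normal_density v) * L2_inner (\<lambda>y. h (- (\<sigma> n * v) + y)) h) \<in> borel_measurable lborel" for n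
      unfolding L2_inner_def by measurable
    show "AE v in lborel. norm (complex_of_real (std_normal_density v) * L2_inner (\<lambda>y. h (- (\<sigma> n * v) + y)) h)
        \<le> (L2_norm h)\<^sup>2 * std_normal_density v" for n
    proof (rule AE_I2)
      fix v
      show "norm (complex_of_real (std_normal_density v) * L2_inner (\<lambda>y. h (- (\<sigma> n * v) + y)) h)
          \<le> (L2_norm h)\<^sup>2 * std_normal_density v"
        using mult_right_mono[OF R[of "- (\<sigma> n * v)"], of "std_normal_density v"]
        by (simp add: norm_mult mult.commute[of "std_normal_density v"])
    qed
    show "AE v in lborel. (\<lambda>n. complex_of_real (std_normal_density v) * L2_inner (\<lambda>y. h (- (\<sigma> n * v) + y)) h)
      \<longlonglongrightarrow> complex_of_real (std_normal_density v) * complex_of_real ((L2_norm h)\<^sup>2)"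
    proof (intro AE_I2 tendsto_mult tendsto_const)
      fix v
      have "(\<lambda>n. - (\<sigma> n * v)) \<longlonglongrightarrow> - (0 * v)" by (intro tendsto_intros \<sigma>0)
      then have t: "(\<lambda>n. - (\<sigma> n * v)) \<longlonglongrightarrow> 0" by simp
      have "(\<lambda>n. L2_norm (\<lambda>y. h (- (\<sigma> n * v) + y) - h y) * L2_norm h) \<longlonglongrightarrow> 0 * L2_norm h"
        by (intro tendsto_mult tendsto_const L2_translation_continuous h t)
      then have lim0: "(\<lambda>n. L2_norm (\<lambda>y. h (- (\<sigma> n * v) + y) - h y) * L2_norm h) \<longlonglongrightarrow> 0" by simp
      have "(\<lambda>n. L2_inner (\<lambda>y. h (- (\<sigma> n * v) + y) - h y) h) \<longlonglongrightarrow> 0"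
        by (rule Lim_null_comparison[OF _ lim0])
           (intro always_eventually allI L2_Cauchy_Schwarz L2_diff L2_translate h)
      then have "(\<lambda>n. L2_inner (\<lambda>y. h (- (\<sigma> n * v) + y)) h - L2_inner h h) \<longlonglongrightarrow> 0"
        unfolding L2_inner_diff_left[OF L2_translate[OF h(2)] h(2) h(2)] .
      then show "(\<lambda>n. L2_inner (\<lambda>y. h (- (\<sigma> n * v) + y)) h) \<longlonglongrightarrow> complex_of_real ((L2_norm h)\<^sup>2)"
        unfolding L2_inner_self[symmetric] by (rule LIM_zero_cancel)
    qed
  qed measurable
  also have "(LINT v|lborel. complex_of_real (std_normal_density v) * complex_of_real ((L2_norm h)\<^sup>2)) = complex_of_real ((L2_norm h)\<^sup>2)"
    using gaussian_fourier[of 0] by simp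
  finally have "(\<lambda>n. complex_of_real (?G n)) \<longlonglongrightarrow> complex_of_real ((L2_norm h)\<^sup>2)"
    unfolding g_def using gaussian_mean_of_fourier_square[OF h \<sigma>] by simp
  then have "?G \<longlonglongrightarrow> (L2_norm h)\<^sup>2" unfolding tendsto_of_real_iff .
  then have "(\<lambda>n. ennreal (?G n)) \<longlonglongrightarrow> ennreal ((L2_norm h)\<^sup>2)" by (rule tendsto_ennrealI)
  with mono have eq: "(\<integral>\<^sup>+\<xi>. ennreal ((cmod (?F \<xi>))\<^sup>2) \<partial>lborel) = ennreal ((L2_norm h)\<^sup>2)"
    unfolding nn by (rule LIMSEQ_unique)
  then show F: "?F \<in> L2"
    by (intro L2_nn_integral_bound(1)[of _ "(L2_norm h)\<^sup>2"] Fm) auto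
  from eq have "(L2_norm ?F)\<^sup>2 = (L2_norm h)\<^sup>2"
    unfolding L2_norm_nn_integral[OF F] by simp
  then show "L2_norm ?F = L2_norm h" by (simp add: L2_norm_nonneg power2_eq_iff_nonneg)
qed

section \<open>Completeness and the Fourier transform on square-integrable functions\<close>

lemma L2_norm_limit:
  assumes "L2_tendsto u f"
  shows "(\<lambda>n. L2_norm (u n)) \<longlonglongrightarrow> L2_norm f"
proof -
  have u: "u n \<in> L2" and f: "f \<in> L2" and l: "(\<lambda>n. L2_norm (\<lambda>x. u n x - f x)) \<longlonglongrightarrow> 0" for n
    using assms by (auto simp: L2_tendsto_def)
  have "(\<lambda>n. L2_norm (u n) - L2_norm f) \<longlonglongrightarrow> 0"
    using L2_norm_reverse_triangle[OF u f] by (intro Lim_null_comparison[OF _ l] always_eventually) simp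
  then show ?thesis by (rule LIM_zero_cancel)
qed

lemma L2_tendstoI:
  assumes "\<And>n. u n \<in> L2" "f \<in> L2" "\<And>n. L2_norm (\<lambda>x. u n x - f x) \<le> e n" "e \<longlonglongrightarrow> 0"
  shows "L2_tendsto u f"
  unfolding L2_tendsto_def
proof (intro conjI allI assms(1,2))
  show "(\<lambda>n. L2_norm (\<lambda>x. u n x - f x)) \<longlonglongrightarrow> 0"
    using assms(3) by (intro Lim_null_comparison[OF _ assms(4)] always_eventually) (simp add: L2_norm_nonneg)
qed

lemma L2_tendsto_diff:
  assumes "L2_tendsto u f" "L2_tendsto v g"
  shows "L2_tendsto (\<lambda>n x. u n x - v n x) (\<lambda>x. f x - g x)"
proof -
  have u: "u n \<in> L2" "f \<in> L2" and v: "v n \<in> L2" "g \<in> L2" for n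
    using assms by (auto simp: L2_tendsto_def)
  show ?thesis
  proof (rule L2_tendstoI)
    show "L2_norm (\<lambda>x. (u n x - v n x) - (f x - g x)) \<le> L2_norm (\<lambda>x. u n x - f x) + L2_norm (\<lambda>x. v n x - g x)" for n
      using L2_norm_triangle_diff[OF L2_diff[OF u] L2_diff[OF v], of n n] by (simp add: algebra_simps)
    show "(\<lambda>n. L2_norm (\<lambda>x. u n x - f x) + L2_norm (\<lambda>x. v n x - g x)) \<longlonglongrightarrow> 0"
      using tendsto_add[of _ 0 _ _ 0] assms by (auto simp: L2_tendsto_def)
  qed (intro L2_diff u v)+
qed

text \<open>
  Closed balls of \<open>L\<^sup>2\<close> are closed under almost everywhere convergence.
\<close>

lemma L2_Fatou:
  assumes v: "\<And>j. v j \<in> L2" and [measurable]: "g \<in> borel_measurable borel"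
    and lim: "AE x in lborel. (\<lambda>j. v j x) \<longlonglongrightarrow> g x" and w: "w \<in> L2"
    and le: "eventually (\<lambda>j. L2_norm (\<lambda>x. v j x - w x) \<le> e) sequentially"
  shows "(\<lambda>x. g x - w x) \<in> L2" "L2_norm (\<lambda>x. g x - w x) \<le> e"
proof -
  have [measurable]: "v j \<in> borel_measurable borel" "w \<in> borel_measurable borel" for j
    using v w by (auto intro: L2_measurable)
  from le obtain j where "L2_norm (\<lambda>x. v j x - w x) \<le> e" by (auto simp: eventually_sequentially)
  then have e: "0 \<le> e" using L2_norm_nonneg order_trans by blast
  have "(\<integral>\<^sup>+x. ennreal ((cmod (g x - w x))\<^sup>2) \<partial>lborel)
      = (\<integral>\<^sup>+x. liminf (\<lambda>j. ennreal ((cmod (v j x - w x))\<^sup>2)) \<partial>lborel)"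
  proof (rule nn_integral_cong_AE)
    show "AE x in lborel. ennreal ((cmod (g x - w x))\<^sup>2) = liminf (\<lambda>j. ennreal ((cmod (v j x - w x))\<^sup>2))"
      using lim
    proof eventually_elim
      case (elim x)
      then have "(\<lambda>j. ennreal ((cmod (v j x - w x))\<^sup>2)) \<longlonglongrightarrow> ennreal ((cmod (g x - w x))\<^sup>2)"
        by (intro tendsto_ennrealI tendsto_intros)
      then show ?case by (intro lim_imp_Liminf[symmetric]) auto
    qed
  qed
  also have "\<dots> \<le> liminf (\<lambda>j. \<integral>\<^sup>+x. ennreal ((cmod (v j x - w x))\<^sup>2) \<partial>lborel)"
    by (intro nn_integral_liminf) measurable
  also have "\<dots> \<le> ennreal (e\<^sup>2)"
  proof (rule Liminf_le)
    show "\<forall>\<^sub>F j in sequentially. (\<integral>\<^sup>+x. ennreal ((cmod (v j x - w x))\<^sup>2) \<partial>lborel) \<le> ennreal (e\<^sup>2)"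
      using le
    proof eventually_elim
      case (elim j)
      then show ?case
        unfolding L2_norm_nn_integral[OF L2_diff[OF v w]]
        by (intro ennreal_leI power_mono L2_norm_nonneg)
    qed
  qed simp
  finally have b: "(\<integral>\<^sup>+x. ennreal ((cmod (g x - w x))\<^sup>2) \<partial>lborel) \<le> ennreal (e\<^sup>2)" .
  show "(\<lambda>x. g x - w x) \<in> L2"
    by (rule L2_nn_integral_bound(1)[OF _ b]) auto
  have "(L2_norm (\<lambda>x. g x - w x))\<^sup>2 \<le> e\<^sup>2"
    by (rule L2_nn_integral_bound(2)[OF _ b]) auto
  then show "L2_norm (\<lambda>x. g x - w x) \<le> e"
    by (rule power2_le_imp_le) (rule e)
qed

text \<open>
  The increments \<open>d\<^sub>j\<close> satisfy \<open>\<parallel>d\<^sub>j\<parallel>\<^sup>2 \<le> 4\<^bsup>-j\<^esup>\<close>, which leaves room for a weight \<open>2\<^sup>j\<close>: the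
  function \<open>\<Sum>j. 2\<^sup>j |d\<^sub>j|\<^sup>2\<close> has finite integral, so almost everywhere \<open>|d\<^sub>j| \<le> 2\<^bsup>-j/2\<^esup>\<close> eventually and
  the telescoping series converges absolutely.
\<close>

lemma L2_rapidly_Cauchy_converges_AE:
  assumes v: "\<And>j. v j \<in> L2" and rapid: "\<And>j. L2_norm (\<lambda>x. v (Suc j) x - v j x) \<le> (1/2) ^ j"
  shows "AE x in lborel. convergent (\<lambda>j. v j x)"
proof -
  define d where "d j x = v (Suc j) x - v j x" for j x
  have d_eq: "d j = (\<lambda>x. v (Suc j) x - v j x)" for j by (simp add: d_def fun_eq_iff)
  have d: "d j \<in> L2" for j unfolding d_eq by (intro L2_diff v)
  have [measurable]: "d j \<in> borel_measurable borel" for j using d by (rule L2_measurable)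
  have "(\<integral>\<^sup>+x. (\<Sum>j. ennreal (2 ^ j * (cmod (d j x))\<^sup>2)) \<partial>lborel)
      = (\<Sum>j. \<integral>\<^sup>+x. ennreal (2 ^ j * (cmod (d j x))\<^sup>2) \<partial>lborel)"
    by (intro nn_integral_suminf) measurable
  also have "\<dots> \<le> (\<Sum>j. ennreal ((1/2) ^ j))"
  proof (intro suminf_le summableI)
    fix j
    have "(\<integral>\<^sup>+x. ennreal (2 ^ j * (cmod (d j x))\<^sup>2) \<partial>lborel) = ennreal (2 ^ j) * (\<integral>\<^sup>+x. ennreal ((cmod (d j x))\<^sup>2) \<partial>lborel)"
      by (simp add: ennreal_mult' nn_integral_cmult)
    also have "\<dots> = ennreal (2 ^ j * (L2_norm (d j))\<^sup>2)"
      by (simp add: L2_norm_nn_integral[OF d] ennreal_mult')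
    also have "\<dots> \<le> ennreal (2 ^ j * ((1/2) ^ j)\<^sup>2)"
      using rapid[of j] unfolding d_eq
      by (intro ennreal_leI mult_left_mono power_mono L2_norm_nonneg) auto
    also have "(2::real) ^ j * ((1/2) ^ j)\<^sup>2 = (1/2) ^ j"
      by (simp add: power2_eq_square power_divide)
    finally show "(\<integral>\<^sup>+x. ennreal (2 ^ j * (cmod (d j x))\<^sup>2) \<partial>lborel) \<le> ennreal ((1/2) ^ j)" .
  qed
  also have "\<dots> = ennreal (\<Sum>j. (1/2) ^ j)"
    by (intro suminf_ennreal2) (auto intro: summable_geometric)
  also have "\<dots> < \<infinity>" by simp
  finally have "AE x in lborel. (\<Sum>j. ennreal (2 ^ j * (cmod (d j x))\<^sup>2)) \<noteq> \<infinity>"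
    by (intro nn_integral_PInf_AE) auto
  then show ?thesis
  proof eventually_elim
    case (elim x)
    have "summable (\<lambda>j. 2 ^ j * (cmod (d j x))\<^sup>2)"
      using elim by (intro summable_suminf_not_top) (auto simp: top_unique)
    then have "(\<lambda>j. 2 ^ j * (cmod (d j x))\<^sup>2) \<longlonglongrightarrow> 0" by (rule summable_LIMSEQ_zero)
    then have "eventually (\<lambda>j. 2 ^ j * (cmod (d j x))\<^sup>2 < 1) sequentially"
      by (rule order_tendstoD) simp
    then have ev: "eventually (\<lambda>j. norm (d j x) \<le> (sqrt (1/2)) ^ j) sequentially"
    proof eventually_elim
      case (elim j)
      have "(cmod (d j x))\<^sup>2 \<le> (1/2) ^ j" using elim by (simp add: field_simps power_one_over)
      also have "\<dots> = ((sqrt (1/2)) ^ j)\<^sup>2"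
        by (simp add: power_mult[symmetric] mult.commute[of j]) (simp add: power_mult power_divide)
      finally show ?case by (rule power2_le_imp_le) simp
    qed
    have "summable (\<lambda>j. (sqrt (1/2)) ^ j)"
      by (intro summable_geometric) (simp add: real_sqrt_divide)
    with ev have "summable (\<lambda>j. d j x)" by (rule summable_comparison_test_ev)
    then have "(\<lambda>n. \<Sum>j<n. d j x) \<longlonglongrightarrow> (\<Sum>j. d j x)" by (rule summable_LIMSEQ)
    moreover have "(\<Sum>j<n. d j x) = v n x - v 0 x" for n
      unfolding d_def by (rule sum_lessThan_telescope)
    ultimately have "(\<lambda>n. v n x - v 0 x + v 0 x) \<longlonglongrightarrow> (\<Sum>j. d j x) + v 0 x"
      by (intro tendsto_add tendsto_const) simp
    then show ?case by (auto simp: convergent_def)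
  qed
qed

text \<open>
  The Riesz--Fischer theorem: a rapidly Cauchy subsequence has a limit almost everywhere, and Fatou's
  lemma shows that the whole sequence converges to it in norm.
\<close>

theorem L2_complete:
  assumes u: "\<And>n. u n \<in> L2"
    and Cauchy: "\<And>e. 0 < e \<Longrightarrow> \<exists>N. \<forall>m\<ge>N. \<forall>n\<ge>N. L2_norm (\<lambda>x. u m x - u n x) < e"
  obtains g where "L2_tendsto u g"
proof -
  have "\<forall>j. \<exists>N. \<forall>m\<ge>N. \<forall>n\<ge>N. L2_norm (\<lambda>x. u m x - u n x) < (1/2) ^ j"
    by (intro allI Cauchy) simp
  then obtain N where N: "\<And>j m n. m \<ge> N j \<Longrightarrow> n \<ge> N j \<Longrightarrow> L2_norm (\<lambda>x. u m x - u n x) < (1/2) ^ j"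
    by metis
  \<comment> \<open>summing the thresholds makes the indices increase\<close>
  define r where "r j = (\<Sum>i\<le>j. N i) + j" for j
  have rN: "N j \<le> r j" for j unfolding r_def by (simp add: member_le_sum trans_le_add1)
  have rS: "r j \<le> r (Suc j)" for j by (simp add: r_def)
  have rge: "j \<le> r j" for j by (simp add: r_def)
  define v where "v j = u (r j)" for j
  have v: "v j \<in> L2" for j unfolding v_def by (rule u)
  have [measurable]: "v j \<in> borel_measurable borel" for j using v by (rule L2_measurable)
  have "L2_norm (\<lambda>x. v (Suc j) x - v j x) \<le> (1/2) ^ j" for j
    unfolding v_def using N[of j "r (Suc j)" "r j"] rN[of j] rS[of j] by simp
  then have conv: "AE x in lborel. convergent (\<lambda>j. v j x)"
    by (intro L2_rapidly_Cauchy_converges_AE v)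
  define g where "g x = lim (\<lambda>j. v j x)" for x
  have gm[measurable]: "g \<in> borel_measurable borel" unfolding g_def by measurable
  have lim: "AE x in lborel. (\<lambda>j. v j x) \<longlonglongrightarrow> g x"
    using conv by eventually_elim (simp add: g_def convergent_LIMSEQ_iff)
  have close: "\<exists>M. \<forall>n\<ge>M. (\<lambda>x. g x - u n x) \<in> L2 \<and> L2_norm (\<lambda>x. g x - u n x) \<le> e" if "0 < e" for e
  proof -
    obtain M where M: "\<forall>m\<ge>M. \<forall>n\<ge>M. L2_norm (\<lambda>x. u m x - u n x) < e" using Cauchy[OF \<open>0 < e\<close>] by blast
    have "eventually (\<lambda>j. L2_norm (\<lambda>x. v j x - u n x) \<le> e) sequentially" if "n \<ge> M" for n
      unfolding eventually_sequentially
    proof (intro exI allI impI)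
      fix j assume "j \<ge> M"
      with rge[of j] have "r j \<ge> M" by linarith
      with M that show "L2_norm (\<lambda>x. v j x - u n x) \<le> e" unfolding v_def by (simp add: less_imp_le)
    qed
    then show ?thesis using L2_Fatou[OF v gm lim u] by (intro exI[of _ M]) blast
  qed
  then obtain M where "(\<lambda>x. g x - u M x) \<in> L2" using zero_less_one by blast
  from L2_add[OF this u[of M]] have g: "g \<in> L2" by simp
  have "(\<lambda>n. L2_norm (\<lambda>x. u n x - g x)) \<longlonglongrightarrow> 0"
  proof (rule LIMSEQ_I)
    fix e :: real assume "0 < e"
    then obtain M where "\<forall>n\<ge>M. (\<lambda>x. g x - u n x) \<in> L2 \<and> L2_norm (\<lambda>x. g x - u n x) \<le> e / 2"
      using close[of "e/2"] by auto
    then show "\<exists>M. \<forall>n\<ge>M. norm (L2_norm (\<lambda>x. u n x - g x) - 0) < e"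
      using \<open>0 < e\<close> by (intro exI[of _ M]) (force simp: L2_norm_nonneg L2_norm_minus_commute[of _ g])
  qed
  with u g show ?thesis by (intro that[of g]) (simp add: L2_tendsto_def)
qed

text \<open>
  The functions through which \<open>fourier\<close> is defined; they are integrable by the Cauchy--Schwarz
  inequality.
\<close>

definition truncation :: "nat \<Rightarrow> (real \<Rightarrow> complex) \<Rightarrow> real \<Rightarrow> complex" where
  "truncation n f = (\<lambda>x. indicator {- real n..real n} x * f x)"

lemma truncation_L2:
  assumes f: "f \<in> L2" shows "truncation n f \<in> L2"
proof (rule L2_I_bound[OF _ L2_integrable[OF f]])
  have [measurable]: "f \<in> borel_measurable borel" using f by (rule L2_measurable)
  show "truncation n f \<in> borel_measurable borel" unfolding truncation_def by measurable
qed (auto simp: truncation_def split: split_indicator)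

lemma truncation_integrable:
  assumes "f \<in> L2" shows "integrable lborel (truncation n f)"
proof -
  have "integrable lborel (indicator {- real n..real n} :: real \<Rightarrow> real)"
    by (simp add: integrable_indicator_iff)
  then have "(\<lambda>x. indicator {- real n..real n} x :: complex) \<in> L2"
    by (rule L2_I_bound[rotated]) (auto split: split_indicator)
  from L2_integrable_mult[OF this assms] show ?thesis by (simp add: truncation_def)
qed

lemma truncation_tendsto:
  assumes f: "f \<in> L2" shows "L2_tendsto (\<lambda>n. truncation n f) f"
proof -
  have [measurable]: "f \<in> borel_measurable borel" using f by (rule L2_measurable)
  have "(\<lambda>n. LINT x|lborel. (cmod (truncation n f x - f x))\<^sup>2) \<longlonglongrightarrow> (LINT x|(lborel::real measure). 0)"
  proof (rule integral_dominated_convergence[where w = "\<lambda>x. (cmod (f x))\<^sup>2"])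
    show "AE x in lborel. (\<lambda>n. (cmod (truncation n f x - f x))\<^sup>2) \<longlonglongrightarrow> 0"
    proof (rule AE_I2)
      fix x
      obtain N :: nat where "\<bar>x\<bar> \<le> real N" using real_arch_simple by blast
      then have "\<forall>n\<ge>N. (cmod (truncation n f x - f x))\<^sup>2 = 0"
        by (auto simp: truncation_def indicator_def)
      then show "(\<lambda>n. (cmod (truncation n f x - f x))\<^sup>2) \<longlonglongrightarrow> 0"
        by (intro tendsto_eventually) (auto simp: eventually_sequentially)
    qed
  qed (auto simp: L2_integrable[OF f] truncation_def split: split_indicator)
  then have "(\<lambda>n. sqrt (LINT x|lborel. (cmod (truncation n f x - f x))\<^sup>2)) \<longlonglongrightarrow> sqrt 0"
    by (intro tendsto_real_sqrt) simp
  then show ?thesis using f by (simp add: L2_tendsto_def L2_norm_def truncation_L2)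
qed

lemma fourier_integral_diff:
  assumes "integrable lborel f" "integrable lborel g"
  shows "fourier_integral (\<lambda>x. f x - g x) \<xi> = fourier_integral f \<xi> - fourier_integral g \<xi>"
proof -
  have *: "integrable lborel (\<lambda>x. h x * cis (- (2 * pi * x * \<xi>)))" if "integrable lborel h" for h :: "real \<Rightarrow> complex"
    using fourier_integral_integrable[OF that, of "- (2 * pi * \<xi>)"] by (simp add: mult_ac)
  show ?thesis unfolding fourier_integral_cis using *[OF assms(1)] *[OF assms(2)] by (simp add: left_diff_distrib)
qed

lemma fourier_integral_lincomb:
  assumes "\<And>i. i \<in> K \<Longrightarrow> integrable lborel (f i)"
  shows "fourier_integral (\<lambda>x. \<Sum>i\<in>K. c i * f i x) \<xi> = (\<Sum>i\<in>K. c i * fourier_integral (f i) \<xi>)"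
proof -
  have *: "integrable lborel (\<lambda>x. f i x * cis (- (2 * pi * x * \<xi>)))" if "i \<in> K" for i
    using fourier_integral_integrable[OF assms[OF that], of "- (2 * pi * \<xi>)"] by (simp add: mult_ac)
  show ?thesis unfolding fourier_integral_cis
    using * by (simp add: sum_distrib_right mult.assoc)
qed

lemma fourier_integral_shift:
  "fourier_integral (shift k f) \<xi> = cis (- (2 * pi * of_int k * \<xi>)) * fourier_integral f \<xi>"
proof -
  have "fourier_integral (shift k f) \<xi> = (LINT x|lborel. shift k f (of_int k + x) * cis (- (2 * pi * (of_int k + x) * \<xi>)))"
    unfolding fourier_integral_cis
    using integral_translate[of "\<lambda>x. shift k f x * cis (- (2 * pi * x * \<xi>))" "of_int k"] by simp
  also have "\<dots> = (LINT x|lborel. cis (- (2 * pi * of_int k * \<xi>)) * (f x * cis (- (2 * pi * x * \<xi>))))"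
  proof (rule Bochner_Integration.integral_cong[OF refl])
    fix x
    have "cis (- (2 * pi * (of_int k + x) * \<xi>)) = cis (- (2 * pi * of_int k * \<xi>)) * cis (- (2 * pi * x * \<xi>))"
      unfolding cis_mult by (simp add: algebra_simps)
    then show "shift k f (of_int k + x) * cis (- (2 * pi * (of_int k + x) * \<xi>))
        = cis (- (2 * pi * of_int k * \<xi>)) * (f x * cis (- (2 * pi * x * \<xi>)))"
      by (simp add: shift_def mult_ac)
  qed
  finally show ?thesis unfolding fourier_integral_cis by simp
qed

text \<open>
  By Plancherel the Fourier integrals of the truncations form a Cauchy sequence, so the limit chosen in
  the definition of \<open>fourier\<close> exists.
\<close>

lemma fourier_limit:
  assumes f: "f \<in> L2"
  shows "L2_tendsto (\<lambda>n. fourier_integral (truncation n f)) (fourier f)"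
proof -
  let ?F = "\<lambda>n. fourier_integral (truncation n f)"
  note P = Plancherel_L1_L2[OF truncation_integrable truncation_L2]
  have t: "truncation n f \<in> L2" for n by (rule truncation_L2[OF f])
  let ?e = "\<lambda>n. L2_norm (\<lambda>x. truncation n f x - f x)"
  have le: "L2_norm (\<lambda>\<xi>. ?F m \<xi> - ?F n \<xi>) \<le> ?e m + ?e n" for m n
  proof -
    have i: "integrable lborel (truncation n f)" for n by (rule truncation_integrable[OF f])
    have "(\<lambda>\<xi>. ?F m \<xi> - ?F n \<xi>) = fourier_integral (\<lambda>x. truncation m f x - truncation n f x)"
      using fourier_integral_diff[OF i i] by auto
    then have "L2_norm (\<lambda>\<xi>. ?F m \<xi> - ?F n \<xi>) = L2_norm (\<lambda>x. truncation m f x - truncation n f x)"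
      using Plancherel_L1_L2(2)[OF Bochner_Integration.integrable_diff[OF i i] L2_diff[OF t t]] by simp
    also have "\<dots> \<le> ?e m + L2_norm (\<lambda>x. f x - truncation n f x)"
      by (rule L2_norm_triangle_via[OF t f t])
    finally show ?thesis by (simp add: L2_norm_minus_commute[of f])
  qed
  have "\<exists>g. L2_tendsto ?F g"
  proof (rule L2_complete[of ?F])
    show "?F n \<in> L2" for n by (rule P(1)[OF f f])
    fix e :: real assume "0 < e"
    have "?e \<longlonglongrightarrow> 0" using truncation_tendsto[OF f] by (simp add: L2_tendsto_def)
    then have "eventually (\<lambda>n. ?e n < e / 2) sequentially" by (rule order_tendstoD) (use \<open>0 < e\<close> in simp)
    then obtain N where N: "\<And>n. n \<ge> N \<Longrightarrow> ?e n < e / 2" by (auto simp: eventually_sequentially)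
    have "L2_norm (\<lambda>\<xi>. ?F m \<xi> - ?F n \<xi>) < e" if "m \<ge> N" "n \<ge> N" for m n
      using le[of m n] N[OF that(1)] N[OF that(2)] by linarith
    then show "\<exists>N. \<forall>m\<ge>N. \<forall>n\<ge>N. L2_norm (\<lambda>\<xi>. ?F m \<xi> - ?F n \<xi>) < e" by blast
  qed blast
  then show ?thesis unfolding fourier_def truncation_def by (rule someI_ex)
qed

section \<open>Synthesis of integer translates on the Fourier side\<close>

definition trig_poly :: "int set \<Rightarrow> (int \<Rightarrow> complex) \<Rightarrow> real \<Rightarrow> complex" where
  "trig_poly K c \<xi> = (\<Sum>k\<in>K. c k * cis (- (2 * pi * of_int k * \<xi>)))"

lemma trig_poly_measurable [measurable]: "trig_poly K c \<in> borel_measurable borel"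
  unfolding trig_poly_def by measurable

lemma trig_poly_periodic: "trig_poly K c (\<xi> + of_int m) = trig_poly K c \<xi>"
proof -
  have "cis (- (2 * pi * of_int k * (\<xi> + of_int m))) = cis (- (2 * pi * of_int k * \<xi>))" for k :: int
  proof -
    have "cis (- (2 * pi * of_int k * (\<xi> + of_int m))) = cis (- (2 * pi * of_int k * \<xi>)) * cis (2 * pi * of_int (- k * m))"
      unfolding cis_mult by (simp add: algebra_simps)
    also have "cis (2 * pi * of_int (- k * m)) = 1" by (rule cis_multiple_2pi) auto
    finally show ?thesis by simp
  qed
  then show ?thesis by (simp add: trig_poly_def)
qed

lemma trig_poly_bound: "cmod (trig_poly K c \<xi>) \<le> (\<Sum>k\<in>K. cmod (c k))"
  unfolding trig_poly_def by (rule order_trans[OF norm_sum]) (simp add: norm_mult)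

lemma L2_bounded_mult:
  assumes f: "f \<in> L2" and [measurable]: "p \<in> borel_measurable borel"
    and b: "\<And>x. cmod (p x) \<le> S"
  shows "(\<lambda>x. p x * f x) \<in> L2" "L2_norm (\<lambda>x. p x * f x) \<le> S * L2_norm f"
proof -
  have [measurable]: "f \<in> borel_measurable borel" using f by (rule L2_measurable)
  have S: "0 \<le> S" using b norm_ge_zero order_trans by blast
  have le: "(cmod (p x * f x))\<^sup>2 \<le> S\<^sup>2 * (cmod (f x))\<^sup>2" for x
    unfolding norm_mult power_mult_distrib by (intro mult_right_mono power_mono b) auto
  have i: "integrable lborel (\<lambda>x. S\<^sup>2 * (cmod (f x))\<^sup>2)" using L2_integrable[OF f] by simp
  show pf: "(\<lambda>x. p x * f x) \<in> L2" by (rule L2_I_bound[OF _ i le]) measurable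
  have "(L2_norm (\<lambda>x. p x * f x))\<^sup>2 \<le> (LINT x|lborel. S\<^sup>2 * (cmod (f x))\<^sup>2)"
    unfolding L2_norm_square by (intro integral_mono L2_integrable[OF pf] i le)
  also have "\<dots> = (S * L2_norm f)\<^sup>2" by (simp add: L2_norm_square power_mult_distrib)
  finally show "L2_norm (\<lambda>x. p x * f x) \<le> S * L2_norm f"
    by (rule power2_le_imp_le) (simp add: S L2_norm_nonneg)
qed

text \<open>
  Taking \<open>d\<close> to \<open>\<Sum>k\<in>K. c\<^sub>k t\<^sub>k d\<close> amounts to multiplying \<open>d^\<close> by \<open>trig_poly K c\<close>. This is an identity
  of Fourier integrals for truncations of \<open>d\<close>, where Plancherel applies; both sides are continuous in
  \<open>L\<^sup>2\<close>.
\<close>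

lemma shift_synthesis_norm:
  assumes d: "d \<in> L2" and D: "L2_tendsto (\<lambda>n. fourier_integral (truncation n d)) D"
  shows "L2_norm (\<lambda>t. \<Sum>k\<in>K. c k * shift k d t) = L2_norm (\<lambda>\<xi>. trig_poly K c \<xi> * D \<xi>)"
proof -
  let ?F = "\<lambda>n. fourier_integral (truncation n d)"
  let ?S = "\<Sum>k\<in>K. cmod (c k)"
  define P where "P f = (\<lambda>t. \<Sum>k\<in>K. c k * shift k f t)" for f
  have DL: "D \<in> L2" and FL: "?F n \<in> L2" and Dlim: "(\<lambda>n. L2_norm (\<lambda>x. ?F n x - D x)) \<longlonglongrightarrow> 0" for n
    using D by (auto simp: L2_tendsto_def)
  have PL: "P f \<in> L2" if "f \<in> L2" for f
    unfolding P_def by (intro L2_sum L2_scale L2_shift that)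
  have t: "truncation n d \<in> L2" and ti: "integrable lborel (truncation n d)" for n
    by (intro truncation_L2 truncation_integrable d)+
  have tsi: "integrable lborel (shift k (truncation n d))" for k n
    unfolding shift_eq_translate by (rule integrable_translate[OF ti])
  have Pn: "L2_norm (P (truncation n d)) = L2_norm (\<lambda>\<xi>. trig_poly K c \<xi> * ?F n \<xi>)" for n
  proof -
    have "integrable lborel (P (truncation n d))"
      unfolding P_def by (intro Bochner_Integration.integrable_sum integrable_mult_right tsi)
    from Plancherel_L1_L2(2)[OF this PL[OF t]]
    have "L2_norm (P (truncation n d)) = L2_norm (fourier_integral (P (truncation n d)))" by simp
    also have "fourier_integral (P (truncation n d)) = (\<lambda>\<xi>. trig_poly K c \<xi> * ?F n \<xi>)"
      unfolding P_def fourier_integral_lincomb[OF tsi] fourier_integral_shift trig_poly_def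
      by (simp add: fun_eq_iff fourier_integral_lincomb[OF tsi] fourier_integral_shift sum_distrib_right mult.assoc)
    finally show ?thesis .
  qed
  have "L2_tendsto (\<lambda>n. P (truncation n d)) (P d)"
  proof (rule L2_tendstoI)
    show "P (truncation n d) \<in> L2" "P d \<in> L2" for n by (intro PL t d)+
    show "L2_norm (\<lambda>x. P (truncation n d) x - P d x) \<le> ?S * L2_norm (\<lambda>x. truncation n d x - d x)" for n
    proof -
      let ?r = "\<lambda>x. truncation n d x - d x"
      have r: "?r \<in> L2" by (intro L2_diff t d)
      have "(\<lambda>x. P (truncation n d) x - P d x) = (\<lambda>x. \<Sum>k\<in>K. c k * shift k ?r x)"
        by (simp add: P_def shift_def sum_subtractf[symmetric] right_diff_distrib)
      then have "L2_norm (\<lambda>x. P (truncation n d) x - P d x) = L2_norm (\<lambda>x. \<Sum>k\<in>K. c k * shift k ?r x)"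
        by (rule arg_cong)
      also have "\<dots> \<le> (\<Sum>k\<in>K. L2_norm (\<lambda>x. c k * shift k ?r x))"
        by (intro L2_norm_sum L2_scale L2_shift r)
      also have "\<dots> = ?S * L2_norm ?r"
        unfolding L2_norm_scale L2_norm_shift by (simp add: sum_distrib_right)
      finally show ?thesis .
    qed
    have "(\<lambda>n. ?S * L2_norm (\<lambda>x. truncation n d x - d x)) \<longlonglongrightarrow> ?S * 0"
      using truncation_tendsto[OF d] by (intro tendsto_mult tendsto_const) (simp add: L2_tendsto_def)
    then show "(\<lambda>n. ?S * L2_norm (\<lambda>x. truncation n d x - d x)) \<longlonglongrightarrow> 0" by simp
  qed
  from L2_norm_limit[OF this] have 1: "(\<lambda>n. L2_norm (P (truncation n d))) \<longlonglongrightarrow> L2_norm (P d)" .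
  have "L2_tendsto (\<lambda>n \<xi>. trig_poly K c \<xi> * ?F n \<xi>) (\<lambda>\<xi>. trig_poly K c \<xi> * D \<xi>)"
  proof (rule L2_tendstoI)
    show "(\<lambda>\<xi>. trig_poly K c \<xi> * ?F n \<xi>) \<in> L2" "(\<lambda>\<xi>. trig_poly K c \<xi> * D \<xi>) \<in> L2" for n
      by (intro L2_bounded_mult(1)[OF _ trig_poly_measurable trig_poly_bound] FL DL)+
    show "L2_norm (\<lambda>\<xi>. trig_poly K c \<xi> * ?F n \<xi> - trig_poly K c \<xi> * D \<xi>) \<le> ?S * L2_norm (\<lambda>\<xi>. ?F n \<xi> - D \<xi>)" for n
    proof -
      have "L2_norm (\<lambda>\<xi>. trig_poly K c \<xi> * (?F n \<xi> - D \<xi>)) \<le> ?S * L2_norm (\<lambda>\<xi>. ?F n \<xi> - D \<xi>)"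
        by (intro L2_bounded_mult(2) L2_diff FL DL trig_poly_measurable trig_poly_bound)
      then show ?thesis by (simp add: right_diff_distrib)
    qed
    have "(\<lambda>n. ?S * L2_norm (\<lambda>x. ?F n x - D x)) \<longlonglongrightarrow> ?S * 0"
      by (intro tendsto_mult tendsto_const Dlim)
    then show "(\<lambda>n. ?S * L2_norm (\<lambda>x. ?F n x - D x)) \<longlonglongrightarrow> 0" by simp
  qed
  from L2_norm_limit[OF this] have 2: "(\<lambda>n. L2_norm (P (truncation n d))) \<longlonglongrightarrow> L2_norm (\<lambda>\<xi>. trig_poly K c \<xi> * D \<xi>)"
    unfolding Pn .
  from LIMSEQ_unique[OF 1 2] show ?thesis by (simp add: P_def)
qed

lemma integral_cis_unit_interval:
  "has_bochner_integral lborel (\<lambda>x. indicator {-1/2..1/2} x *\<^sub>R cis (2 * pi * of_int m * x)) (if m = 0 then 1 else 0)"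
proof (cases "m = 0")
  case True
  have "has_bochner_integral lborel (\<lambda>x::real. indicator {-1/2..1/2} x *\<^sub>R (1::complex)) (measure lborel {-1/2..1/2::real} *\<^sub>R 1)"
    by (intro has_bochner_integral_scaleR_left has_bochner_integral_real_indicator) auto
  then show ?thesis using True by simp
next
  case False
  define A :: complex where "A = \<i> * of_real (2 * pi * of_int m)"
  have A: "A \<noteq> 0" using False by (simp add: A_def)
  have e: "cis (2 * pi * of_int m * x) = exp (x *\<^sub>R A)" for x
    by (simp add: cis_conv_exp scaleR_conv_of_real A_def mult_ac)
  let ?F = "\<lambda>x. exp (x *\<^sub>R A) * inverse A"
  have "has_bochner_integral lborel (\<lambda>x. indicator {-1/2..1/2} x *\<^sub>R exp (x *\<^sub>R A)) (?F (1/2) - ?F (-1/2))"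
  proof (rule has_bochner_integral_FTC_Icc)
    show "(?F has_vector_derivative exp (x *\<^sub>R A)) (at x within {-1/2..1/2})" for x
      using has_vector_derivative_mult_left[OF exp_scaleR_has_vector_derivative_right[of A x], of "inverse A"]
      by (simp only: mult.assoc right_inverse[OF A] mult_1_right)
    show "continuous_on {-1/2..1/2} (\<lambda>x. exp (x *\<^sub>R A))" by (intro continuous_intros)
  qed simp
  moreover have "?F (1/2) - ?F (-1/2) = 0"
  proof -
    have "cis (2 * pi * of_int m * (1/2)) = cis (2 * pi * of_int m * (-1/2)) * cis (2 * pi * of_int m)"
      unfolding cis_mult by simp
    also have "cis (2 * pi * of_int m) = 1" by (rule cis_multiple_2pi) auto
    finally show ?thesis unfolding e by simp
  qed
  ultimately have "has_bochner_integral lborel (\<lambda>x. indicator {-1/2..1/2} x *\<^sub>R exp (x *\<^sub>R A)) 0"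
    by (simp only:)
  then show ?thesis using False unfolding e by simp
qed

lemma trig_poly_Parseval:
  assumes K: "finite K"
  shows "(\<integral>\<^sup>+x. ennreal ((cmod (trig_poly K c x))\<^sup>2) * indicator {-1/2..1/2} x \<partial>lborel) = ennreal (\<Sum>k\<in>K. (cmod (c k))\<^sup>2)"
proof -
  have expand: "complex_of_real ((cmod (trig_poly K c x))\<^sup>2) = (\<Sum>k\<in>K. \<Sum>l\<in>K. (c k * cnj (c l)) * cis (2 * pi * of_int (l - k) * x))" for x
  proof -
    have "complex_of_real ((cmod (trig_poly K c x))\<^sup>2) = trig_poly K c x * cnj (trig_poly K c x)"
      by (rule complex_norm_square)
    also have "\<dots> = (\<Sum>k\<in>K. \<Sum>l\<in>K. (c k * cis (- (2 * pi * of_int k * x))) * (cnj (c l) * cis (2 * pi * of_int l * x)))"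
      unfolding trig_poly_def cnj_sum sum_product by (simp add: cis_cnj)
    also have "\<dots> = (\<Sum>k\<in>K. \<Sum>l\<in>K. (c k * cnj (c l)) * cis (2 * pi * of_int (l - k) * x))"
    proof (intro sum.cong refl)
      fix k l
      have "cis (2 * pi * of_int (l - k) * x) = cis (- (2 * pi * of_int k * x)) * cis (2 * pi * of_int l * x)"
        unfolding cis_mult by (simp add: algebra_simps)
      then show "(c k * cis (- (2 * pi * of_int k * x))) * (cnj (c l) * cis (2 * pi * of_int l * x))
          = (c k * cnj (c l)) * cis (2 * pi * of_int (l - k) * x)" by (simp add: mult_ac)
    qed
    finally show ?thesis .
  qed
  have "has_bochner_integral lborel
      (\<lambda>x. \<Sum>k\<in>K. \<Sum>l\<in>K. (c k * cnj (c l)) * (indicator {-1/2..1/2} x *\<^sub>R cis (2 * pi * of_int (l - k) * x)))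
      (\<Sum>k\<in>K. \<Sum>l\<in>K. (c k * cnj (c l)) * (if l - k = 0 then 1 else 0))"
    by (intro has_bochner_integral_sum has_bochner_integral_mult_right integral_cis_unit_interval)
  also have "(\<Sum>k\<in>K. \<Sum>l\<in>K. (c k * cnj (c l)) * (if l - k = 0 then 1 else 0)) = (\<Sum>k\<in>K. c k * cnj (c k))"
    using K by (intro sum.cong refl) (simp add: if_distrib[of "\<lambda>z. _ * z"] cong: if_cong)
  also have "\<dots> = complex_of_real (\<Sum>k\<in>K. (cmod (c k))\<^sup>2)"
    by (simp add: complex_norm_square del: of_real_power)
  also have "(\<lambda>x. \<Sum>k\<in>K. \<Sum>l\<in>K. (c k * cnj (c l)) * (indicator {-1/2..1/2} x *\<^sub>R cis (2 * pi * of_int (l - k) * x)))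
    = (\<lambda>x. complex_of_real ((cmod (trig_poly K c x))\<^sup>2 * indicator {-1/2..1/2} x))"
    unfolding of_real_mult expand by (auto simp: fun_eq_iff sum_distrib_right split: split_indicator)
  finally have "has_bochner_integral lborel (\<lambda>x. (cmod (trig_poly K c x))\<^sup>2 * indicator {-1/2..1/2} x) (\<Sum>k\<in>K. (cmod (c k))\<^sup>2)"
    unfolding has_bochner_integral_iff complex_of_real_integrable_eq integral_complex_of_real of_real_eq_iff .
  then have "(\<integral>\<^sup>+x. ennreal ((cmod (trig_poly K c x))\<^sup>2 * indicator {-1/2..1/2} x) \<partial>lborel) = ennreal (\<Sum>k\<in>K. (cmod (c k))\<^sup>2)"
    by (intro nn_integral_eq_integral[THEN trans]) (auto simp: has_bochner_integral_iff)
  then show ?thesis by (simp add: ennreal_mult' ennreal_indicator)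
qed

text \<open>
  The half-open unit intervals around the integers tile the line; translating each of them onto the one
  around \<open>0\<close> turns the integral into that of the periodization of \<open>F\<close>.
\<close>

lemma nn_integral_periodization_le:
  fixes F G :: "real \<Rightarrow> ennreal"
  assumes [measurable]: "F \<in> borel_measurable borel"
    and le: "AE x in lborel. x \<in> {-1/2..<1/2} \<longrightarrow> (\<forall>K. finite K \<longrightarrow> (\<Sum>k\<in>K. F (x + of_int k)) \<le> G x)"
  shows "(\<integral>\<^sup>+x. F x \<partial>lborel) \<le> (\<integral>\<^sup>+x. G x * indicator {-1/2..1/2} x \<partial>lborel)"
proof -
  define I where "I k = {of_int k - 1/2..<of_int k + 1/2::real}" for k :: int
  define Z where "Z N = {- int N..int N}" for N
  \<comment> \<open>so every point lies in exactly one tile\<close>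
  have I_iff: "x \<in> I k \<longleftrightarrow> k = \<lfloor>x + 1/2\<rfloor>" for x k
    by (auto simp: I_def floor_eq_iff) linarith+
  have ind: "(\<Sum>k\<in>Z N. indicator (I k) x) = (if \<lfloor>x + 1/2\<rfloor> \<in> Z N then 1 else 0 :: ennreal)" for N x
  proof -
    have "(\<Sum>k\<in>Z N. indicator (I k) x) = (\<Sum>k\<in>Z N. if \<lfloor>x + 1/2\<rfloor> = k then 1 else 0 :: ennreal)"
      by (intro sum.cong refl) (auto simp: indicator_def I_iff)
    then show ?thesis by (simp add: Z_def)
  qed
  have [measurable]: "I k \<in> sets borel" for k by (simp add: I_def)
  have "(\<lambda>N. \<integral>\<^sup>+x. F x * (\<Sum>k\<in>Z N. indicator (I k) x) \<partial>lborel) \<longlonglongrightarrow> (\<integral>\<^sup>+x. F x \<partial>lborel)"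
  proof (rule nn_integral_LIMSEQ)
    show "incseq (\<lambda>N x. F x * (\<Sum>k\<in>Z N. indicator (I k) x))"
      unfolding ind by (auto simp: incseq_def le_fun_def Z_def)
    show "(\<lambda>N. F x * (\<Sum>k\<in>Z N. indicator (I k) x)) \<longlonglongrightarrow> F x" for x
    proof (rule tendsto_eventually)
      have "\<lfloor>x + 1/2\<rfloor> \<in> Z N" if "nat \<bar>\<lfloor>x + 1/2\<rfloor>\<bar> \<le> N" for N using that by (auto simp: Z_def)
      then show "\<forall>\<^sub>F N in sequentially. F x * (\<Sum>k\<in>Z N. indicator (I k) x) = F x"
        unfolding ind eventually_sequentially by (intro exI[of _ "nat \<bar>\<lfloor>x + 1/2\<rfloor>\<bar>"]) auto
    qed
  qed measurable
  moreover have "(\<integral>\<^sup>+x. F x * (\<Sum>k\<in>Z N. indicator (I k) x) \<partial>lborel) \<le> (\<integral>\<^sup>+x. G x * indicator {-1/2..1/2} x \<partial>lborel)" for N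
  proof -
    have "(\<integral>\<^sup>+x. F x * (\<Sum>k\<in>Z N. indicator (I k) x) \<partial>lborel) = (\<Sum>k\<in>Z N. \<integral>\<^sup>+x. F x * indicator (I k) x \<partial>lborel)"
      unfolding sum_distrib_left by (intro nn_integral_sum) measurable
    also have "\<dots> = (\<Sum>k\<in>Z N. \<integral>\<^sup>+x. F (x + of_int k) * indicator {-1/2..<1/2} x \<partial>lborel)"
    proof (intro sum.cong refl)
      fix k
      have "(\<integral>\<^sup>+x. F x * indicator (I k) x \<partial>lborel) = (\<integral>\<^sup>+x. F (of_int k + 1 * x) * indicator (I k) (of_int k + 1 * x) \<partial>lborel)"
        using nn_integral_real_affine[of "\<lambda>x. F x * indicator (I k) x" 1 "of_int k"] by simp
      also have "\<dots> = (\<integral>\<^sup>+x. F (x + of_int k) * indicator {-1/2..<1/2} x \<partial>lborel)"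
        by (intro nn_integral_cong) (auto simp: I_def add.commute split: split_indicator)
      finally show "(\<integral>\<^sup>+x. F x * indicator (I k) x \<partial>lborel) = (\<integral>\<^sup>+x. F (x + of_int k) * indicator {-1/2..<1/2} x \<partial>lborel)" .
    qed
    also have "\<dots> = (\<integral>\<^sup>+x. (\<Sum>k\<in>Z N. F (x + of_int k)) * indicator {-1/2..<1/2} x \<partial>lborel)"
      unfolding sum_distrib_right by (intro nn_integral_sum[symmetric]) measurable
    also have "\<dots> \<le> (\<integral>\<^sup>+x. G x * indicator {-1/2..1/2} x \<partial>lborel)"
    proof (rule nn_integral_mono_AE)
      show "AE x in lborel. (\<Sum>k\<in>Z N. F (x + of_int k)) * indicator {-1/2..<1/2} x \<le> G x * indicator {-1/2..1/2} x"
        using le by eventually_elim (auto simp: Z_def split: split_indicator)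
    qed
    finally show ?thesis .
  qed
  ultimately show ?thesis by (intro LIMSEQ_le_const2) auto
qed

lemma finite_sum_le_infsum_ennreal:
  fixes f :: "'a \<Rightarrow> ennreal"
  assumes "finite K" shows "(\<Sum>k\<in>K. f k) \<le> (\<Sum>\<^sub>\<infinity>k. f k)"
  unfolding nonneg_infsum_complete[of UNIV f, simplified]
  using assms by (intro SUP_upper) auto

text \<open>
  Since \<open>trig_poly K c\<close> has period \<open>1\<close>, it factors out of the periodization of
  \<open>|trig_poly K c \<cdot> D|\<^sup>2\<close>. What remains is at most \<open>\<mu>\<close>, and the integral of \<open>|trig_poly K c|\<^sup>2\<close> over a
  period is \<open>\<parallel>c\<parallel>\<^sup>2\<close> by Parseval.
\<close>

theorem periodization_synthesis_bound:
  assumes d: "d \<in> L2" and D: "L2_tendsto (\<lambda>n. fourier_integral (truncation n d)) D" and "0 \<le> \<mu>"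
    and per: "AE \<zeta> in lborel. \<zeta> \<in> {-1/2..<1/2} \<longrightarrow>
       (\<Sum>\<^sub>\<infinity>k::int. ennreal ((cmod (D (\<zeta> + of_int k)))\<^sup>2)) \<le> ennreal \<mu>"
  shows "synthesis_bound (\<lambda>k. shift k d) \<mu>"
  unfolding synthesis_bound_def
proof (intro conjI allI impI)
  show "0 \<le> \<mu>" by fact
  fix K :: "int set" and c :: "int \<Rightarrow> complex" assume K: "finite K"
  let ?p = "trig_poly K c" and ?s = "\<Sum>k\<in>K. (cmod (c k))\<^sup>2"
  have s: "0 \<le> ?s" by (simp add: sum_nonneg)
  have [measurable]: "D \<in> borel_measurable borel" using D by (auto simp: L2_tendsto_def L2_measurable)
  have "(\<integral>\<^sup>+\<xi>. ennreal ((cmod (?p \<xi> * D \<xi>))\<^sup>2) \<partial>lborel)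
      \<le> (\<integral>\<^sup>+\<xi>. ennreal \<mu> * ennreal ((cmod (?p \<xi>))\<^sup>2) * indicator {-1/2..1/2} \<xi> \<partial>lborel)"
  proof (rule nn_integral_periodization_le)
    show "AE \<xi> in lborel. \<xi> \<in> {-1/2..<1/2} \<longrightarrow> (\<forall>K. finite K \<longrightarrow>
       (\<Sum>k\<in>K. ennreal ((cmod (?p (\<xi> + of_int k) * D (\<xi> + of_int k)))\<^sup>2)) \<le> ennreal \<mu> * ennreal ((cmod (?p \<xi>))\<^sup>2))"
      using per
    proof (eventually_elim, intro impI allI)
      fix \<xi> :: real and L :: "int set"
      assume *: "\<xi> \<in> {-1/2..<1/2} \<longrightarrow> (\<Sum>\<^sub>\<infinity>k::int. ennreal ((cmod (D (\<xi> + of_int k)))\<^sup>2)) \<le> ennreal \<mu>"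
        "\<xi> \<in> {-1/2..<1/2}" "finite L"
      have "(\<Sum>k\<in>L. ennreal ((cmod (?p (\<xi> + of_int k) * D (\<xi> + of_int k)))\<^sup>2))
          = ennreal ((cmod (?p \<xi>))\<^sup>2) * (\<Sum>k\<in>L. ennreal ((cmod (D (\<xi> + of_int k)))\<^sup>2))"
        unfolding trig_poly_periodic by (simp add: norm_mult power_mult_distrib ennreal_mult' sum_distrib_left del: sum_ennreal)
      also have "\<dots> \<le> ennreal ((cmod (?p \<xi>))\<^sup>2) * ennreal \<mu>"
        using * finite_sum_le_infsum_ennreal[OF *(3), of "\<lambda>k. ennreal ((cmod (D (\<xi> + of_int k)))\<^sup>2)"]
        by (intro mult_left_mono) auto
      finally show "(\<Sum>k\<in>L. ennreal ((cmod (?p (\<xi> + of_int k) * D (\<xi> + of_int k)))\<^sup>2)) \<le> ennreal \<mu> * ennreal ((cmod (?p \<xi>))\<^sup>2)"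
        by (simp add: mult.commute)
    qed
  qed measurable
  also have "\<dots> = ennreal \<mu> * (\<integral>\<^sup>+\<xi>. ennreal ((cmod (?p \<xi>))\<^sup>2) * indicator {-1/2..1/2} \<xi> \<partial>lborel)"
    unfolding mult.assoc by (intro nn_integral_cmult) measurable
  also have "\<dots> = ennreal (\<mu> * ?s)"
    unfolding trig_poly_Parseval[OF K] using \<open>0 \<le> \<mu>\<close> by (simp add: ennreal_mult')
  finally have "(L2_norm (\<lambda>\<xi>. ?p \<xi> * D \<xi>))\<^sup>2 \<le> \<mu> * ?s"
    by (rule L2_nn_integral_bound(2)[rotated]) (use \<open>0 \<le> \<mu>\<close> s in auto)
  then show "(L2_norm (\<lambda>t. \<Sum>k\<in>K. c k * shift k d t))\<^sup>2 \<le> \<mu> * ?s"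
    unfolding shift_synthesis_norm[OF d D] .
qed

section \<open>Woven Riesz bases of translates\<close>

theorem proposition4p6:
  fixes V :: "(real \<Rightarrow> complex) set" and \<phi> \<psi> :: "real \<Rightarrow> complex" and A B :: real
  assumes "shift_invariant_space V"
    and "\<phi> \<in> L2"
    and "riesz_generator V \<phi>"
    and "riesz_bounds (\<lambda>k::int. shift k \<phi>) A B"
    and "\<psi> \<in> V"
    and "\<exists>\<mu>>0. AE \<zeta> in lborel. \<zeta> \<in> {-1/2..<1/2} \<longrightarrow>
           (\<Sum>\<^sub>\<infinity>k::int. ennreal ((cmod (fourier \<phi> (\<zeta> + of_int k) - fourier \<psi> (\<zeta> + of_int k)))\<^sup>2)) \<le> ennreal \<mu> \<and>
           \<mu> < A \<and>
           ennreal A < (\<Sum>\<^sub>\<infinity>k::int. ennreal ((cmod (fourier \<phi> (\<zeta> + of_int k)))\<^sup>2))"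
  shows "riesz_basis V (\<lambda>k::int. shift k \<psi>) \<and>
         woven V (\<lambda>k. shift k \<psi>) (\<lambda>k. shift k \<phi>)"
proof -
  from assms(6) obtain \<mu> where \<mu>: "0 < \<mu>"
    and ae: "AE \<zeta> in lborel. \<zeta> \<in> {-1/2..<1/2} \<longrightarrow>
           (\<Sum>\<^sub>\<infinity>k::int. ennreal ((cmod (fourier \<phi> (\<zeta> + of_int k) - fourier \<psi> (\<zeta> + of_int k)))\<^sup>2)) \<le> ennreal \<mu> \<and>
           \<mu> < A \<and>
           ennreal A < (\<Sum>\<^sub>\<infinity>k::int. ennreal ((cmod (fourier \<phi> (\<zeta> + of_int k)))\<^sup>2))"
    by blast
  have V: "closed_L2_subspace V" and inv: "\<And>f k. f \<in> V \<Longrightarrow> shift k f \<in> V"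
    using assms(1) by (auto simp: shift_invariant_space_def)
  have fr: "frame_of V (\<lambda>k::int. shift k \<phi>)"
    using assms(3) by (simp add: riesz_generator_def riesz_basis_def)
  have shV: "shift k \<phi> \<in> V" "shift k \<psi> \<in> V" for k
    using fr inv[OF assms(5)] by (auto simp: frame_of_def)
  have \<psi>: "\<psi> \<in> L2" using closed_L2_subspace_L2[OF V assms(5)] .
  \<comment> \<open>the period has positive measure, so the a.e. condition holds somewhere in it\<close>
  have "\<mu> < A"
  proof (rule ccontr)
    assume "\<not> \<mu> < A"
    with ae have "AE \<zeta> in lborel. \<zeta> \<notin> {-1/2..<1/2::real}" by (auto elim: eventually_mono)
    then have "{-1/2..<1/2::real} \<in> null_sets lborel"
      by (subst AE_iff_null_sets) auto
    then show False by (simp add: null_sets_def)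
  qed
  define d where "d = (\<lambda>x. \<phi> x - \<psi> x)"
  have d: "d \<in> L2" unfolding d_def by (intro L2_diff assms(2) \<psi>)
  have "fourier_integral (truncation n d) = (\<lambda>\<xi>. fourier_integral (truncation n \<phi>) \<xi> - fourier_integral (truncation n \<psi>) \<xi>)" for n
    using fourier_integral_diff[OF truncation_integrable[OF assms(2)] truncation_integrable[OF \<psi>], of n n]
    by (simp add: fun_eq_iff d_def truncation_def right_diff_distrib)
  then have D: "L2_tendsto (\<lambda>n. fourier_integral (truncation n d)) (\<lambda>\<xi>. fourier \<phi> \<xi> - fourier \<psi> \<xi>)"
    using L2_tendsto_diff[OF fourier_limit[OF assms(2)] fourier_limit[OF \<psi>]] by simp
  have "synthesis_bound (\<lambda>k. shift k d) \<mu>"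
  proof (rule periodization_synthesis_bound[OF d D])
    show "0 \<le> \<mu>" using \<mu> by simp
    show "AE \<zeta> in lborel. \<zeta> \<in> {-1/2..<1/2} \<longrightarrow>
       (\<Sum>\<^sub>\<infinity>k::int. ennreal ((cmod (fourier \<phi> (\<zeta> + of_int k) - fourier \<psi> (\<zeta> + of_int k)))\<^sup>2)) \<le> ennreal \<mu>"
      using ae by eventually_elim blast
  qed
  then have bound: "synthesis_bound (\<lambda>k t. if k \<in> J then shift k d t else 0) \<mu>" for J
    by (rule synthesis_bound_restrict)
  have mixed: "riesz_basis V (\<lambda>k. if k \<in> J then shift k \<psi> else shift k \<phi>)" for J :: "int set"
  proof (rule riesz_basis_perturbation[OF V fr assms(4) _ _ \<open>\<mu> < A\<close>])
    show "(if k \<in> J then shift k \<psi> else shift k \<phi>) \<in> V" for k using shV by simp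
    have "(\<lambda>k t. shift k \<phi> t - (if k \<in> J then shift k \<psi> else shift k \<phi>) t) = (\<lambda>k t. if k \<in> J then shift k d t else 0)"
      by (auto simp: fun_eq_iff d_def shift_def)
    with bound[of J] show "synthesis_bound (\<lambda>k t. shift k \<phi> t - (if k \<in> J then shift k \<psi> else shift k \<phi>) t) \<mu>"
      by simp
  qed
  have "riesz_basis V (\<lambda>k::int. shift k \<psi>)" using mixed[of UNIV] by simp
  then show ?thesis
    using fr mixed by (auto simp: woven_def riesz_basis_def)
qed

end
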